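(* In the contention game with $k=2$ channels under acknowledgement-based feedback, consider any anonymous, memoryless protocol with the property that $\Pr\{X_{i,t}=0\}=0$ for every $t\ge 1$ (i.e., a pending player never stays idle). If the number of players is $n>4$, then no such protocol is an equilibrium protocol.
   Context: Contention game: $n$ players, channel set $K=\{1,\dots,k\}$, discrete time slots $t=1,2,\dots$. Each player has one packet; initially all players are pending. In each slot a pending player chooses (possibly at random) an action in $A=\{0,1,\dots,k\}$, where $0$ means no transmission and $a\in K$ means transmitting on channel $a$; $X_{i,t}$ denotes player $i$'s action at slot $t$. If exactly one player transmits on a channel in a slot, she succeeds and leaves the game; if two or more transmit on the same channel they collide and remain pending. A protocol is a sequence of decision rules giving, for each slot, a probability distribution on $A$ as a function of the player's available information. Latency $T_i$ = slot of player $i$'s successful transmission; players minimize expected latency. Acknowledgement-based feedback: only a player who attempted transmission learns whether she succeeded; decision rules depend only on the personal history $(X_{i,1},\dots,X_{i,t-1})$. Memoryless: the decision rule at slot $t$ does not depend on the personal history. Anonymous: all players use the same protocol, independent of identity. Equilibrium protocol: the profile in which all players use it is such that no player, at any slot and after any history, can decrease her (conditional) expected latency by unilaterally deviating. *)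

theory Defs
  imports "HOL-Probability.Probability"
begin

text \<open>Contention game, acknowledgement-based feedback.  Actions are natural numbers:
  0 = idle, a \<in> {1..k} = transmit on channel a.  We track a fixed (tagged) player i.
  The state at the start of a slot is either None (player i has already succeeded)
  or Some (h, m): player i is pending, h is her personal history of actions
  (her feedback so far is only ``not yet succeeded''), and m is the number of
  OTHER players still pending.  The other players all use the same memoryless
  protocol p (p t = distribution of the action at slot t).\<close>

definition others_succ :: "nat \<Rightarrow> nat \<Rightarrow> (nat \<Rightarrow> nat) \<Rightarrow> nat" where
  "others_succ m a f = card {j. j < m \<and> f j \<noteq> 0 \<and> f j \<noteq> a \<and>
                                (\<forall>j'<m. j' \<noteq> j \<longrightarrow> f j' \<noteq> f j)}"

definition cg_step :: "(nat \<Rightarrow> nat pmf) \<Rightarrow> (nat \<Rightarrow> nat list \<Rightarrow> nat pmf) \<Rightarrow> nat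
    \<Rightarrow> (nat list \<times> nat) option \<Rightarrow> (nat list \<times> nat) option pmf" where
  "cg_step p \<sigma> t s = (case s of
      None \<Rightarrow> return_pmf None
    | Some (h, m) \<Rightarrow>
        bind_pmf (\<sigma> t h) (\<lambda>a.
        bind_pmf (Pi_pmf {..<m} 0 (\<lambda>_. p t)) (\<lambda>f.
          return_pmf (if a \<noteq> 0 \<and> (\<forall>j<m. f j \<noteq> a) then None
                      else Some (h @ [a], m - others_succ m a f)))))"

text \<open>cg_state n p \<sigma> t = distribution of the state at the start of slot t+1
  (slots are numbered 1,2,...), when player i uses the behavioural strategy \<sigma>
  and the other n-1 players use the memoryless protocol p.\<close>
fun cg_state :: "nat \<Rightarrow> (nat \<Rightarrow> nat pmf) \<Rightarrow> (nat \<Rightarrow> nat list \<Rightarrow> nat pmf) \<Rightarrow> nat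
    \<Rightarrow> (nat list \<times> nat) option pmf" where
  "cg_state n p \<sigma> 0 = return_pmf (Some ([], n - 1))"
| "cg_state n p \<sigma> (Suc t) = bind_pmf (cg_state n p \<sigma> t) (cg_step p \<sigma> (Suc t))"

definition cg_pending :: "nat \<Rightarrow> (nat \<Rightarrow> nat pmf) \<Rightarrow> (nat \<Rightarrow> nat list \<Rightarrow> nat pmf)
    \<Rightarrow> nat \<Rightarrow> nat list \<Rightarrow> real" where
  "cg_pending n p \<sigma> t h = measure_pmf.prob (cg_state n p \<sigma> (t - 1))
      {s. \<exists>h' m. s = Some (h', m) \<and> take (length h) h' = h}"

text \<open>Conditional expected latency E[T_i | i pending at slot t with history h]
  (length h = t - 1), via the tail-sum formula
  E[T | B] = sum over s \<ge> 0 of P(T > s | B), where T > s iff pending at slot s+1;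
  the terms s < t equal 1.  Value in ennreal (may be infinite).\<close>
definition cond_latency :: "nat \<Rightarrow> (nat \<Rightarrow> nat pmf) \<Rightarrow> (nat \<Rightarrow> nat list \<Rightarrow> nat pmf)
    \<Rightarrow> nat \<Rightarrow> nat list \<Rightarrow> ennreal" where
  "cond_latency n p \<sigma> t h =
     ennreal (real t) +
     (\<Sum>s. ennreal (cg_pending n p \<sigma> (t + s + 1) h / cg_pending n p \<sigma> t h))"

definition memoryless_protocol :: "nat \<Rightarrow> (nat \<Rightarrow> nat pmf) \<Rightarrow> bool" where
  "memoryless_protocol k p \<longleftrightarrow> (\<forall>t. set_pmf (p t) \<subseteq> {0..k})"

definition memoryless_equilibrium :: "nat \<Rightarrow> nat \<Rightarrow> (nat \<Rightarrow> nat pmf) \<Rightarrow> bool" where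
  "memoryless_equilibrium n k p \<longleftrightarrow>
     (\<forall>t\<ge>1. \<forall>h. length h = t - 1 \<and> cg_pending n p (\<lambda>s _. p s) t h > 0 \<longrightarrow>
        (\<forall>\<sigma>. (\<forall>s g. set_pmf (\<sigma> s g) \<subseteq> {0..k}) \<longrightarrow>
           cond_latency n p (\<lambda>s _. p s) t h
             \<le> cond_latency n p (\<lambda>s g. if s < t then p s else \<sigma> s g) t h))"

end

theory Submission
  imports Defs
begin

text \<open>Write \<open>q \<ge> 1/2\<close> and \<open>p = 1 - q\<close> for the probabilities of the more and the less popular channel of a
  slot.  The unnormalised belief of a pending player (\<open>f m\<close> is the probability of being pending together
  with \<open>m\<close> others) evolves linearly, by \<open>step q\<close> or \<open>step p\<close> according to the channel she uses.  In an
  equilibrium every never-idle sequence of channels is optimal.  Hence \<open>p\<close> is bounded away from 0, and the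
  future cost functional vanishes on \<open>step q f - step p f\<close> for all \<open>f\<close> in the span of the reachable beliefs.

  The minimal degree \<open>k\<close> of a nonzero element of this span is eventually constant, and from then on the
  monic element of degree \<open>k\<close> evolves in the same way under both channels, up to a scalar.  If \<open>q > 1/2\<close>
  infinitely often, this is absurd: for \<open>k = 1\<close> and \<open>k = 2\<close> the monic element is an eigenvector of nonzero
  cost, and for \<open>k \<ge> 3\<close> its coefficients from index 2 on become positive, which is incompatible with the
  proportionality in a slot with \<open>q > 1/2\<close>.  So \<open>q = 1/2\<close> from some slot on.  Then future costs are explicit,
  and a player who has always used the less popular channel gains by idling once: idling costs \<open>1/6\<close> if two
  others are pending, is neutral for one or three, gains \<open>1/5\<close> for four and something for more, and her belief
  puts at most \<open>8/7\<close> times as much weight on two others as on four.\<close>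

section \<open>Outcome of one slot\<close>

text \<open>Here \<open>x\<close> is the probability that another pending player uses the channel of the tagged player and
  \<open>m\<close> is the number of others.  She succeeds if all of them are on the other channel, which for \<open>m = 1\<close>
  is also the only way in which the other player succeeds; hence the case distinction.\<close>

definition fall :: "real \<Rightarrow> nat \<Rightarrow> real" where
  "fall x m = (if 2 \<le> m then real m * x ^ (m - 1) * (1 - x) else 0)"

definition stay :: "real \<Rightarrow> nat \<Rightarrow> real" where
  "stay x m = 1 - (1 - x) ^ m - fall x m"

definition idle_fall :: "real \<Rightarrow> nat \<Rightarrow> real" where
  "idle_fall x m = real m * (x ^ (m - 1) * (1 - x) + (1 - x) ^ (m - 1) * x)"

text \<open>Two others on different channels both succeed, so that state 2 falls to 0 and not to 1.\<close>

definition idle_kernel :: "real \<Rightarrow> nat \<Rightarrow> nat \<Rightarrow> real" where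
  "idle_kernel x m m' =
    (if m \<le> 1 then of_bool (m' = 0)
     else if m = 2 then 2 * x * (1 - x) * of_bool (m' = 0) + (1 - 2 * x * (1 - x)) * of_bool (m' = 2)
     else (1 - idle_fall x m) * of_bool (m' = m) + idle_fall x m * of_bool (m = Suc m'))"

definition slot_outcome :: "nat \<Rightarrow> nat \<Rightarrow> (nat \<Rightarrow> nat) \<Rightarrow> nat option" where
  "slot_outcome a m f = (if a \<noteq> 0 \<and> (\<forall>j<m. f j \<noteq> a) then None
     else Some (m - others_succ m a f))"

definition slot_pmf :: "nat pmf \<Rightarrow> nat \<Rightarrow> nat \<Rightarrow> nat option pmf" where
  "slot_pmf P a m = map_pmf (slot_outcome a m) (Pi_pmf {..<m} 0 (\<lambda>_. P))"

text \<open>Outside \<open>{..<m}\<close> the value is the default 0 of \<open>Pi_pmf\<close>, so an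
  outcome of the other players' choices can be equal to a profile as a function.\<close>

definition profile :: "nat \<Rightarrow> nat \<Rightarrow> nat \<Rightarrow> nat" where
  "profile m c = (\<lambda>j. if j < m then c else 0)"

lemma pmf_profile:
  "pmf (Pi_pmf {..<m} 0 (\<lambda>_. P)) (profile m c) = pmf P c ^ m"
  by (subst pmf_Pi) (auto simp: profile_def)

lemma pmf_profile_upd:
  assumes "j < m"
  shows "pmf (Pi_pmf {..<m} 0 (\<lambda>_. P)) ((profile m c)(j := d)) = pmf P c ^ (m - 1) * pmf P d"
proof -
  have "pmf (Pi_pmf {..<m} 0 (\<lambda>_. P)) ((profile m c)(j := d))
      = (\<Prod>i<m. pmf P (if i = j then d else c))"
    using assms by (subst pmf_Pi) (auto simp: profile_def intro!: prod.cong)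
  also have "\<dots> = pmf P d * (\<Prod>i\<in>{..<m} - {j}. pmf P c)"
    using assms by (subst prod.remove[of _ j]) auto
  also have "\<dots> = pmf P c ^ (m - 1) * pmf P d"
    using assms by simp
  finally show ?thesis .
qed

lemma inj_profile_upd: "c \<noteq> d \<Longrightarrow> inj_on (\<lambda>j. (profile m c)(j := d)) {..<m}"
  by (rule inj_onI) (metis fun_upd_apply lessThan_iff profile_def)

lemma prob_profile_upd:
  assumes "c \<noteq> d"
  shows "measure_pmf.prob (Pi_pmf {..<m} 0 (\<lambda>_. P)) ((\<lambda>j. (profile m c)(j := d)) ` {..<m})
    = real m * (pmf P c ^ (m - 1) * pmf P d)"
proof -
  have "measure_pmf.prob (Pi_pmf {..<m} 0 (\<lambda>_. P)) ((\<lambda>j. (profile m c)(j := d)) ` {..<m})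
    = (\<Sum>j<m. pmf (Pi_pmf {..<m} 0 (\<lambda>_. P)) ((profile m c)(j := d)))"
    using inj_profile_upd[OF assms] by (simp add: measure_measure_pmf_finite sum.reindex)
  then show ?thesis by (simp add: pmf_profile_upd)
qed

lemma set_Pi_pmf_two:
  fixes m :: nat
  assumes "set_pmf P \<subseteq> {a, b}" "f \<in> set_pmf (Pi_pmf {..<m} 0 (\<lambda>_. P))"
  shows "j < m \<Longrightarrow> f j = a \<or> f j = b" "\<not> j < m \<Longrightarrow> f j = 0"
proof -
  have "f \<in> PiE_dflt {..<m} 0 (set_pmf \<circ> (\<lambda>_. P))"
    using assms(2) by (simp add: set_Pi_pmf)
  then have f: "f i \<in> (if i < m then set_pmf P else {0})" for i
    by (cases "i < m") (auto simp: PiE_dflt_def)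
  show "j < m \<Longrightarrow> f j = a \<or> f j = b" "\<not> j < m \<Longrightarrow> f j = 0"
    using f[of j] assms(1) by auto
qed

lemma prob_support_cong:
  "(\<And>f. f \<in> set_pmf N \<Longrightarrow> f \<in> A \<longleftrightarrow> f \<in> B) \<Longrightarrow> measure_pmf.prob N A = measure_pmf.prob N B"
  by (intro measure_pmf.finite_measure_eq_AE) (auto simp: AE_measure_pmf_iff)

lemma pmf_three:
  fixes N :: "nat option pmf"
  assumes "set_pmf N \<subseteq> {None, Some u, Some v}" "u \<noteq> v"
  shows "pmf N (Some u) = 1 - pmf N None - pmf N (Some v)"
proof -
  have "1 = sum (pmf N) {None, Some u, Some v}"
    using sum_pmf_eq_1[OF _ assms(1)] by simp
  then show ?thesis using assms(2) by simp
qed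

text \<open>Another player succeeds only if she is alone on \<open>b\<close>, so at most one does,
  and all the rest are on \<open>a\<close>. For \<open>m = 1\<close> this profile is
  \<open>profile m b\<close>; the test for \<open>None\<close> comes first because the tagged player
  then succeeds too.\<close>

lemma slot_outcome_transmit:
  assumes "a \<noteq> 0" "b \<noteq> 0" "a \<noteq> b"
    and f: "\<And>j. j < m \<Longrightarrow> f j = a \<or> f j = b" "\<And>j. \<not> j < m \<Longrightarrow> f j = 0"
  shows "slot_outcome a m f = (if f = profile m b then None
    else if f \<in> (\<lambda>j. (profile m a)(j := b)) ` {..<m} then Some (m - 1) else Some m)"
proof -
  have *: "(\<forall>j<m. f j \<noteq> a) \<longleftrightarrow> f = profile m b"
    using assms by (auto simp: profile_def fun_eq_iff)
  define S where "S = {j. j < m \<and> f j \<noteq> 0 \<and> f j \<noteq> a \<and> (\<forall>j'<m. j' \<noteq> j \<longrightarrow> f j' \<noteq> f j)}"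
  have S: "S = {j. j < m \<and> f = (profile m a)(j := b)}"
    unfolding S_def using assms by (auto simp: profile_def fun_eq_iff)
  have "card S = (if f \<in> (\<lambda>j. (profile m a)(j := b)) ` {..<m} then 1 else 0)"
  proof (cases "f \<in> (\<lambda>j. (profile m a)(j := b)) ` {..<m}")
    case True
    then obtain j where j: "j < m" "f = (profile m a)(j := b)" by auto
    have "S = {j}" unfolding S using j inj_profile_upd[OF \<open>a \<noteq> b\<close>, of m]
      by (auto dest: inj_onD)
    then show ?thesis using True by simp
  next
    case False
    then have "S = {}" unfolding S by auto
    then show ?thesis using False by simp
  qed
  then have "others_succ m a f = (if f \<in> (\<lambda>j. (profile m a)(j := b)) ` {..<m} then 1 else 0)"
    unfolding others_succ_def S_def .
  then show ?thesis
    using * \<open>a \<noteq> 0\<close> by (simp add: slot_outcome_def)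
qed

lemma pmf_slot_transmit:
  assumes ab: "a \<noteq> 0" "b \<noteq> 0" "a \<noteq> b" and P: "set_pmf P \<subseteq> {a, b}"
  shows "pmf (slot_pmf P a m) (Some m') =
    (if m' = m then stay (pmf P a) m else 0) + (if m = Suc m' then fall (pmf P a) m else 0)"
proof -
  let ?N = "Pi_pmf {..<m} 0 (\<lambda>_. P)"
  let ?one = "(\<lambda>j. (profile m a)(j := b)) ` {..<m}"
  have pb: "pmf P b = 1 - pmf P a"
    using sum_pmf_eq_1[OF _ P] ab by simp
  have out: "f \<in> set_pmf ?N \<Longrightarrow> slot_outcome a m f = (if f = profile m b then None
    else if f \<in> ?one then Some (m - 1) else Some m)" for f
    by (rule slot_outcome_transmit[OF ab]) (use set_Pi_pmf_two[OF P] in auto)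
  have supp: "set_pmf (slot_pmf P a m) \<subseteq> {None, Some m, Some (m - 1)}"
    unfolding slot_pmf_def by (auto simp: out)
  have none: "pmf (slot_pmf P a m) None = (1 - pmf P a) ^ m"
  proof -
    have "pmf (slot_pmf P a m) None = measure_pmf.prob ?N (slot_outcome a m -` {None})"
      by (simp add: slot_pmf_def pmf_map)
    also have "\<dots> = measure_pmf.prob ?N {profile m b}"
      by (rule prob_support_cong) (auto simp: out)
    finally show ?thesis by (simp add: measure_pmf_single pmf_profile pb)
  qed
  show ?thesis
  proof (cases "m \<ge> 2")
    case True
    have nb: "profile m b \<notin> ?one"
    proof
      assume "profile m b \<in> ?one"
      then obtain j where j: "j < m" "profile m b = (profile m a)(j := b)" by auto
      obtain i where "i < m" "i \<noteq> j" using True by (cases "j = 0") (auto intro: that[of 0] that[of 1])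
      with fun_cong[OF j(2), of i] ab show False by (simp add: profile_def)
    qed
    have one: "pmf (slot_pmf P a m) (Some (m - 1)) = fall (pmf P a) m"
    proof -
      have "pmf (slot_pmf P a m) (Some (m-1)) = measure_pmf.prob ?N (slot_outcome a m -` {Some (m - 1)})"
        by (simp add: slot_pmf_def pmf_map)
      also have "\<dots> = measure_pmf.prob ?N ?one"
        using True nb by (intro prob_support_cong) (auto simp: out)
      finally show ?thesis using True ab pb by (simp add: prob_profile_upd fall_def)
    qed
    have "pmf (slot_pmf P a m) (Some m) = stay (pmf P a) m"
      using pmf_three[OF supp] True one by (simp add: none stay_def)
    moreover have "m' \<noteq> m \<Longrightarrow> m \<noteq> Suc m' \<Longrightarrow> pmf (slot_pmf P a m) (Some m') = 0"
      using supp by (auto simp: pmf_eq_0_set_pmf)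
    ultimately show ?thesis using one True by auto
  next
    case False
    have no: "f \<in> set_pmf ?N \<Longrightarrow> slot_outcome a m f = (if f = profile m b then None else Some m)" for f
    proof -
      have "(profile m a)(j := b) = profile m b" if "j < m" for j
        using False that by (auto simp: profile_def fun_eq_iff)
      then have "f \<in> ?one \<Longrightarrow> f = profile m b" by (elim imageE) (metis lessThan_iff)
      then show "f \<in> set_pmf ?N \<Longrightarrow> ?thesis" by (metis out)
    qed
    \<comment> \<open>For \<open>m = 0\<close> the value \<open>m - 1\<close> equals
      \<open>m\<close>; the impossible value \<open>Suc m\<close> serves as the distinct third
      outcome for \<open>pmf_three\<close>.\<close>
    have supp': "set_pmf (slot_pmf P a m) \<subseteq> {None, Some m, Some (Suc m)}"
      unfolding slot_pmf_def by (auto simp: no)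
    have "Some (Suc m) \<notin> set_pmf (slot_pmf P a m)"
      unfolding slot_pmf_def by (auto simp: no)
    then have "pmf (slot_pmf P a m) (Some m) = stay (pmf P a) m"
      using pmf_three[OF supp'] False by (simp add: none stay_def fall_def pmf_eq_0_set_pmf)
    moreover have "m' \<noteq> m \<Longrightarrow> pmf (slot_pmf P a m) (Some m') = 0"
      using no by (auto simp: pmf_eq_0_set_pmf slot_pmf_def)
    ultimately show ?thesis using False by (auto simp: fall_def)
  qed
qed

text \<open>A third player is on \<open>a\<close> in one profile and on \<open>b\<close> in the
  other. For two players the two families coincide, which is why state 2 is separate in
  \<open>idle_kernel\<close>.\<close>

lemma profile_upd_neq:
  assumes "a \<noteq> b" "3 \<le> m"
  shows "(profile m a)(j := b) \<noteq> (profile m b)(i := a)"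
proof
  assume eq: "(profile m a)(j := b) = (profile m b)(i := a)"
  have "card {i, j} \<le> 2" by (simp add: card_insert_if)
  then have "\<not> {..<m} \<subseteq> {i, j}" using assms(2) card_mono[of "{i, j}" "{..<m}"] by auto
  then obtain l where "l < m" "l \<noteq> i" "l \<noteq> j" by auto
  with fun_cong[OF eq, of l] assms(1) show False by (simp add: profile_def)
qed

lemma profile_upd_inj:
  assumes "a \<noteq> b" "i < m" "j < m" "(profile m a)(i := b) = (profile m a)(j := b)"
  shows "i = j"
  using inj_onD[OF inj_profile_upd[OF assms(1), of m] assms(4)] assms(2,3) by simp

text \<open>When the tagged player is idle, a success is possible on either channel. Both channels
  have a success only if exactly two others are present; with three or more, at most one player is
  alone on her channel.\<close>

lemma slot_outcome_idle:
  assumes ab: "a \<noteq> 0" "b \<noteq> 0" "a \<noteq> b"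
    and f: "\<And>j. j < m \<Longrightarrow> f j = a \<or> f j = b" "\<And>j. \<not> j < m \<Longrightarrow> f j = 0"
  shows "slot_outcome 0 m f = (if m \<le> 1 then Some 0
    else if m = 2 then (if f \<in> (\<lambda>j. (profile m a)(j := b)) ` {..<m} then Some 0 else Some 2)
    else if f \<in> (\<lambda>j. (profile m a)(j := b)) ` {..<m} \<union> (\<lambda>j. (profile m b)(j := a)) ` {..<m}
      then Some (m - 1) else Some m)"
proof -
  define S where "S = {j. j < m \<and> f j \<noteq> 0 \<and> f j \<noteq> 0 \<and> (\<forall>j'<m. j' \<noteq> j \<longrightarrow> f j' \<noteq> f j)}"
  have out: "slot_outcome 0 m f = Some (m - card S)"
    by (simp add: slot_outcome_def others_succ_def S_def)
  consider "m = 0" | "m = 1" | "m = 2" | "m \<ge> 3" by linarith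
  then show ?thesis
  proof cases
    case 1 then show ?thesis using out by simp
  next
    case 2
    then have "S = {0}" unfolding S_def using f ab by auto
    then show ?thesis using 2 out by simp
  next
    case 3
    have all: "(\<forall>j<m. P j) \<longleftrightarrow> P 0 \<and> P 1" for P using 3 by (auto simp: less_2_cases_iff)
    have one: "f \<in> (\<lambda>j. (profile m a)(j := b)) ` {..<m} \<longleftrightarrow> f 0 \<noteq> f 1"
    proof
      assume "f \<in> (\<lambda>j. (profile m a)(j := b)) ` {..<m}"
      then show "f 0 \<noteq> f 1" using ab 3 by (auto simp: profile_def split: if_splits)
    next
      assume ne: "f 0 \<noteq> f 1"
      show "f \<in> (\<lambda>j. (profile m a)(j := b)) ` {..<m}"
      proof (cases "f 0 = b")
        case True
        then have "f = (profile m a)(0 := b)"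
          using f[of 1] f(2) ne 3 by (auto simp: profile_def fun_eq_iff less_2_cases_iff)
        then show ?thesis by (rule image_eqI) (simp add: 3)
      next
        case False
        then have "f = (profile m a)(1 := b)"
          using f[of 0] f[of 1] f(2) ne 3 by (auto simp: profile_def fun_eq_iff less_2_cases_iff)
        then show ?thesis by (rule image_eqI) (simp add: 3)
      qed
    qed
    have nz: "f 0 \<noteq> 0" "f 1 \<noteq> 0" using f(1)[of 0] f(1)[of 1] ab 3 by auto
    have "j \<in> S \<longleftrightarrow> (j = 0 \<or> j = 1) \<and> f 0 \<noteq> f 1" for j
      unfolding S_def mem_Collect_eq all using nz 3
      by (cases "j = 0"; cases "j = 1") auto
    then have "S = {j. (j = 0 \<or> j = 1) \<and> f 0 \<noteq> f 1}" by blast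
    also have "\<dots> = (if f 0 = f 1 then {} else {0, 1})" by (cases "f 0 = f 1") auto
    finally have "card S = (if f 0 = f 1 then 0 else 2)" by simp
    then show ?thesis unfolding one using 3 out by simp
  next
    case 4
    have S: "S = {j. j < m \<and> f = (profile m a)(j := b)} \<union> {j. j < m \<and> f = (profile m b)(j := a)}"
      unfolding S_def using f ab by (auto simp: profile_def fun_eq_iff)
    have "card S = of_bool (f \<in> (\<lambda>j. (profile m a)(j := b)) ` {..<m} \<union> (\<lambda>j. (profile m b)(j := a)) ` {..<m})"
    proof (cases "S = {}")
      case True
      then show ?thesis unfolding S by auto
    next
      case False
      then obtain j where j: "j < m"
        "f = (profile m a)(j := b) \<or> f = (profile m b)(j := a)" unfolding S by auto
      have "S \<subseteq> {j}"
      proof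
        fix i assume "i \<in> S"
        then have "i < m" "f = (profile m a)(i := b) \<or> f = (profile m b)(i := a)"
          unfolding S by blast+
        then have "i = j"
          using j profile_upd_neq[OF ab(3) 4] profile_upd_inj[OF ab(3), of i m j]
            profile_upd_inj[OF ab(3)[symmetric], of i m j]
          by metis
        then show "i \<in> {j}" by simp
      qed
      moreover have "j \<in> S" unfolding S using j by blast
      ultimately have "S = {j}" by blast
      then show ?thesis using j by auto
    qed
    then show ?thesis using 4 by (simp add: out)
  qed
qed

lemma pmf_slot_idle:
  assumes ab: "a \<noteq> 0" "b \<noteq> 0" "a \<noteq> b" and P: "set_pmf P \<subseteq> {a, b}"
  shows "pmf (slot_pmf P 0 m) (Some m') = idle_kernel (pmf P a) m m'"
proof -
  let ?N = "Pi_pmf {..<m} 0 (\<lambda>_. P)"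
  let ?one = "(\<lambda>j. (profile m a)(j := b)) ` {..<m}"
  let ?two = "(\<lambda>j. (profile m b)(j := a)) ` {..<m}"
  have pb: "pmf P b = 1 - pmf P a"
    using sum_pmf_eq_1[OF _ P] ab by simp
  have out: "f \<in> set_pmf ?N \<Longrightarrow> slot_outcome 0 m f = (if m \<le> 1 then Some 0
    else if m = 2 then (if f \<in> ?one then Some 0 else Some 2)
    else if f \<in> ?one \<union> ?two then Some (m - 1) else Some m)" for f
    by (rule slot_outcome_idle[OF ab]) (use set_Pi_pmf_two[OF P] in auto)
  have prob: "pmf (slot_pmf P 0 m) y = measure_pmf.prob ?N (slot_outcome 0 m -` {y})" for y
    by (simp add: slot_pmf_def pmf_map)
  consider "m \<le> 1" | "m = 2" | "m \<ge> 3" by linarith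
  then show ?thesis
  proof cases
    case 1
    have "slot_pmf P 0 m = map_pmf (\<lambda>_. Some 0) ?N"
      unfolding slot_pmf_def using 1 by (intro map_pmf_cong) (auto simp: out)
    then show ?thesis using 1 by (simp add: idle_kernel_def map_pmf_const pmf_return)
  next
    case 2
    then have out2: "f \<in> set_pmf ?N \<Longrightarrow> slot_outcome 0 m f = (if f \<in> ?one then Some 0 else Some 2)" for f
      using out[of f] by simp
    have supp: "set_pmf (slot_pmf P 0 m) \<subseteq> {None, Some 2, Some 0}"
      unfolding slot_pmf_def by (auto simp: out2)
    have none: "None \<notin> set_pmf (slot_pmf P 0 m)"
      unfolding slot_pmf_def by (auto simp: out2)
    have "pmf (slot_pmf P 0 m) (Some 0) = measure_pmf.prob ?N ?one"
      unfolding prob by (intro prob_support_cong) (auto simp: out2)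
    then have zero: "pmf (slot_pmf P 0 m) (Some 0) = 2 * pmf P a * (1 - pmf P a)"
      using 2 ab by (simp add: prob_profile_upd pb)
    have "pmf (slot_pmf P 0 m) (Some 2) = 1 - 2 * pmf P a * (1 - pmf P a)"
      using pmf_three[OF supp] none zero by (simp add: pmf_eq_0_set_pmf)
    moreover have "m' \<noteq> 0 \<Longrightarrow> m' \<noteq> 2 \<Longrightarrow> pmf (slot_pmf P 0 m) (Some m') = 0"
      using supp by (auto simp: pmf_eq_0_set_pmf)
    ultimately show ?thesis using zero 2 by (auto simp: idle_kernel_def)
  next
    case 3
    have supp: "set_pmf (slot_pmf P 0 m) \<subseteq> {None, Some m, Some (m - 1)}"
      unfolding slot_pmf_def using 3 by (auto simp: out)
    have none: "None \<notin> set_pmf (slot_pmf P 0 m)"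
      unfolding slot_pmf_def using 3 by (auto simp: out)
    have "?one \<inter> ?two = {}"
      using profile_upd_neq[OF ab(3) 3] by blast
    then have "measure_pmf.prob ?N (?one \<union> ?two)
        = measure_pmf.prob ?N ?one + measure_pmf.prob ?N ?two"
      by (intro measure_pmf.finite_measure_Union) auto
    also have "\<dots> = idle_fall (pmf P a) m"
      using ab by (simp add: prob_profile_upd idle_fall_def pb algebra_simps)
    finally have "pmf (slot_pmf P 0 m) (Some (m - 1)) = idle_fall (pmf P a) m"
      unfolding prob using 3 by (subst prob_support_cong[of _ _ "?one \<union> ?two"]) (auto simp: out)
    moreover from this have "pmf (slot_pmf P 0 m) (Some m) = 1 - idle_fall (pmf P a) m"
      using pmf_three[OF supp] none 3 by (simp add: pmf_eq_0_set_pmf)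
    moreover have "m' \<noteq> m \<Longrightarrow> m \<noteq> Suc m' \<Longrightarrow> pmf (slot_pmf P 0 m) (Some m') = 0"
      using supp by (auto simp: pmf_eq_0_set_pmf)
    ultimately show ?thesis using 3 by (auto simp: idle_kernel_def)
  qed
qed

section \<open>The number of pending others under strategies that ignore the history\<close>

definition pending_pmf :: "nat \<Rightarrow> (nat \<Rightarrow> nat pmf) \<Rightarrow> (nat \<Rightarrow> nat pmf) \<Rightarrow> nat \<Rightarrow> nat option pmf" where
  "pending_pmf n p \<tau> t = map_pmf (map_option snd) (cg_state n p (\<lambda>s _. \<tau> s) t)"

lemma pending_pmf_0: "pending_pmf n p \<tau> 0 = return_pmf (Some (n - 1))"
  by (simp add: pending_pmf_def)

text \<open>Since \<open>\<tau>\<close> depends on the slot only, forgetting the personal history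
  leaves a Markov chain on the number of pending others.\<close>

lemma pending_pmf_Suc:
  "pending_pmf n p \<tau> (Suc t) = bind_pmf (pending_pmf n p \<tau> t)
    (\<lambda>s. case s of None \<Rightarrow> return_pmf None
      | Some m \<Rightarrow> bind_pmf (\<tau> (Suc t)) (\<lambda>a. slot_pmf (p (Suc t)) a m))"
  unfolding pending_pmf_def cg_state.simps map_bind_pmf bind_map_pmf
  by (intro bind_pmf_cong refl)
    (auto simp: cg_step_def slot_pmf_def slot_outcome_def map_pmf_def bind_assoc_pmf
      bind_return_pmf intro!: bind_pmf_cong split: option.split)

lemma set_pending_pmf: "set_pmf (pending_pmf n p \<tau> t) \<subseteq> insert None (Some ` {..n - 1})"
proof (induction t)
  case 0
  then show ?case by (simp add: pending_pmf_0)
next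
  case (Suc t)
  have *: "set_pmf (slot_pmf P a m) \<subseteq> insert None (Some ` {..n - 1})" if "m \<le> n - 1" for P a m
    using that by (auto simp: slot_pmf_def slot_outcome_def)
  have "set_pmf (case s of None \<Rightarrow> return_pmf None
      | Some m \<Rightarrow> bind_pmf (\<tau> (Suc t)) (\<lambda>a. slot_pmf (p (Suc t)) a m)) \<subseteq> insert None (Some ` {..n - 1})"
    if "s \<in> set_pmf (pending_pmf n p \<tau> t)" for s
  proof (cases s)
    case (Some m)
    then have "m \<le> n - 1" using that Suc by auto
    then show ?thesis using *[of m] by (simp only: Some option.case set_bind_pmf UN_subset_iff) simp
  qed simp
  then show ?case
    unfolding pending_pmf_Suc set_bind_pmf by (intro UN_least)
qed

lemma pmf_pending_Suc:
  "pmf (pending_pmf n p \<tau> (Suc t)) (Some m')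
    = (\<Sum>m\<le>n - 1. pmf (pending_pmf n p \<tau> t) (Some m)
        * pmf (bind_pmf (\<tau> (Suc t)) (\<lambda>a. slot_pmf (p (Suc t)) a m)) (Some m'))"
proof -
  let ?D = "pending_pmf n p \<tau> t"
  let ?k = "\<lambda>s. case s of None \<Rightarrow> return_pmf None
      | Some m \<Rightarrow> bind_pmf (\<tau> (Suc t)) (\<lambda>a. slot_pmf (p (Suc t)) a m)"
  have "pmf (pending_pmf n p \<tau> (Suc t)) (Some m') = (\<integral>s. pmf (?k s) (Some m') \<partial>measure_pmf ?D)"
    by (simp add: pending_pmf_Suc pmf_bind)
  also have "\<dots> = (\<Sum>s\<in>insert None (Some ` {..n - 1}). pmf ?D s * pmf (?k s) (Some m'))"
    by (subst integral_measure_pmf[OF _ ]) (use set_pending_pmf[of n p \<tau> t] in auto)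
  also have "\<dots> = (\<Sum>s\<in>Some ` {..n - 1}. pmf ?D s * pmf (?k s) (Some m'))"
    by (subst sum.insert) auto
  finally show ?thesis by (simp add: sum.reindex)
qed

text \<open>Every history extends \<open>[]\<close>, so the event is just that the tagged player is
  still pending.\<close>

lemma cg_pending_nil:
  "cg_pending n p (\<lambda>s _. \<tau> s) (Suc t) [] = (\<Sum>m\<le>n - 1. pmf (pending_pmf n p \<tau> t) (Some m))"
proof -
  have "cg_pending n p (\<lambda>s _. \<tau> s) (Suc t) [] = measure_pmf.prob (pending_pmf n p \<tau> t) (- {None})"
    unfolding cg_pending_def pending_pmf_def measure_map_pmf
    by (intro arg_cong2[where f = measure_pmf.prob]) auto
  also have "\<dots> = measure_pmf.prob (pending_pmf n p \<tau> t) (Some ` {..n - 1})"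
    by (rule prob_support_cong) (use set_pending_pmf[of n p \<tau> t] in auto)
  also have "\<dots> = (\<Sum>m\<le>n - 1. pmf (pending_pmf n p \<tau> t) (Some m))"
    by (simp add: measure_measure_pmf_finite sum.reindex)
  finally show ?thesis .
qed

section \<open>Evolution of the unnormalised belief\<close>

lemma fall_nonneg: "0 \<le> x \<Longrightarrow> x \<le> 1 \<Longrightarrow> 0 \<le> fall x m"
  by (simp add: fall_def)

lemma stay_0: "stay x 0 = 0" and stay_1: "stay x (Suc 0) = x" and stay_2: "stay x 2 = x\<^sup>2"
  by (simp_all add: stay_def fall_def power2_eq_square algebra_simps)

lemma fall_0: "fall x 0 = 0" and fall_1: "fall x (Suc 0) = 0"
  and fall_2: "fall x 2 = 2 * x * (1 - x)" and fall_3: "fall x 3 = 3 * x\<^sup>2 * (1 - x)"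
  by (simp_all add: fall_def)

text \<open>If all others share the tagged player's channel, nobody succeeds. For
  \<open>m \<ge> 2\<close> this is the term of the binomial expansion of 1 that remains after the
  two subtracted in \<open>stay\<close>.\<close>

lemma stay_ge_power:
  assumes "0 \<le> x" "x \<le> 1" "1 \<le> m"
  shows "x ^ m \<le> stay x m"
proof (cases "m = 1")
  case True
  then show ?thesis using stay_1[of x] by simp
next
  case False
  then have m: "2 \<le> m" using assms by simp
  let ?t = "\<lambda>k. real (m choose k) * x ^ k * (1 - x) ^ (m - k)"
  have "sum ?t {0, m - 1, m} \<le> sum ?t {..m}"
    using assms by (intro sum_mono2) auto
  also have "\<dots> = (x + (1 - x)) ^ m" by (subst binomial_ring) simp
  finally have "(1 - x) ^ m + real m * x ^ (m - 1) * (1 - x) + x ^ m \<le> 1"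
    using m binomial_symmetric[of 1 m] by simp
  then show ?thesis using m by (simp add: stay_def fall_def)
qed

lemma stay_pos: "0 < x \<Longrightarrow> x \<le> 1 \<Longrightarrow> 1 \<le> m \<Longrightarrow> 0 < stay x m"
  using stay_ge_power[of x m] zero_less_power[of x m] by linarith

lemma stay_nonneg: "0 \<le> x \<Longrightarrow> x \<le> 1 \<Longrightarrow> 0 \<le> stay x m"
  using stay_ge_power[of x m] zero_le_power[of x m] stay_0[of x]
  by (cases "m = 0") (simp, linarith)

lemma stay_le_1: "0 \<le> x \<Longrightarrow> x \<le> 1 \<Longrightarrow> stay x m \<le> 1"
  using fall_nonneg[of x m] zero_le_power[of "1 - x" m] unfolding stay_def by linarith

lemma stay_plus_fall: "stay x m + fall x m = 1 - (1 - x) ^ m"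
  by (simp add: stay_def)

text \<open>For the unpopular channel this bounds the quotients \<open>stay x n / stay x k\<close>
  by 1, as the use of \<open>eventually_bounded_below\<close> requires.\<close>

lemma stay_Suc_mono:
  assumes "0 \<le> x" "x \<le> 1/2" "2 \<le> m"
  shows "stay x m \<le> stay x (Suc m)"
proof -
  obtain k where m: "m = Suc (Suc k)" using assms(3) by (metis Suc_le_D numeral_2_eq_2 le_Suc_eq Suc_le_mono)
  let ?y = "1 - x"
  have "stay x (Suc m) - stay x m
      = x * ?y * (?y ^ Suc k - x ^ Suc k) + real m * x ^ Suc k * ?y\<^sup>2"
    by (simp add: stay_def fall_def m power2_eq_square algebra_simps)
  moreover have "x ^ Suc k \<le> ?y ^ Suc k"
    using assms by (intro power_mono) auto
  then have "0 \<le> x * ?y * (?y ^ Suc k - x ^ Suc k)" "0 \<le> real m * x ^ Suc k * ?y\<^sup>2"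
    using assms by auto
  ultimately show ?thesis by linarith
qed

lemma stay_mono:
  assumes "0 \<le> x" "x \<le> 1/2" "2 \<le> m" "m \<le> k"
  shows "stay x m \<le> stay x k"
  using assms(4)
proof (induction rule: dec_induct)
  case (step n)
  then show ?case using stay_Suc_mono[OF assms(1,2), of n] assms(3) by simp
qed simp

text \<open>The difference of the two sides is
  \<open>p * q * (q ^ (m - 1) - p ^ (m - 1))\<close>.\<close>

lemma power_diff_mono:
  fixes p q :: real
  assumes "p + q = 1" "0 \<le> p" "p \<le> q" "1 \<le> m"
  shows "q ^ Suc m - p ^ Suc m \<le> q ^ m - p ^ m"
proof -
  have "(q ^ m - p ^ m) - (q ^ Suc m - p ^ Suc m) = q ^ m * p - p ^ m * q"
  proof -
    have "1 - q = p" "1 - p = q" using assms(1) by auto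
    then have "q ^ m * (1 - q) = q ^ m * p" "p ^ m * (1 - p) = p ^ m * q" by auto
    then show ?thesis by (simp add: algebra_simps)
  qed
  also have "\<dots> = p * q * (q ^ (m - 1) - p ^ (m - 1))"
    using assms(4) by (cases m) (auto simp: algebra_simps)
  also have "\<dots> \<ge> 0"
    using assms by (intro mult_nonneg_nonneg) (auto intro: power_mono)
  finally show ?thesis by simp
qed

lemma power_diff_le:
  fixes p q :: real
  assumes "p + q = 1" "0 \<le> p" "p \<le> q" "1 \<le> m"
  shows "q ^ m - p ^ m \<le> q - p"
  using assms(4)
proof (induction rule: dec_induct)
  case (step n)
  then show ?case using power_diff_mono[OF assms(1-3), of n] by simp
qed simp

text \<open>For \<open>p > 0\<close> the leading coefficients of degree \<open>k\<close> shrink by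
  factors whose ratio is at most \<open>q / p\<close> from degree 3 on, whereas at degree 2 it is
  \<open>(q / p) ^ 2\<close>. This gap rules out a minimal degree of 3 or more.\<close>

lemma stay_ratio:
  fixes p q :: real
  assumes "p + q = 1" "0 \<le> p" "p \<le> q" "3 \<le> k"
  shows "p * stay q k \<le> q * stay p k"
proof -
  obtain j where k: "k = j + 3" using assms(4) by (metis le_add_diff_inverse2)
  have pq: "1 - p = q" "1 - q = p" using assms(1) by auto
  have "q * stay p k - p * stay q k
      = (q - p) - (q ^ Suc k - p ^ Suc k) + real k * p\<^sup>2 * q\<^sup>2 * (q ^ j - p ^ j)"
    unfolding stay_def fall_def pq by (simp add: k power_add eval_nat_numeral algebra_simps)
  moreover have "q ^ Suc k - p ^ Suc k \<le> q - p"
    using power_diff_le[OF assms(1-3), of "Suc k"] by simp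
  moreover have "0 \<le> real k * p\<^sup>2 * q\<^sup>2 * (q ^ j - p ^ j)"
    using assms by (intro mult_nonneg_nonneg) (auto intro: power_mono)
  ultimately show ?thesis by linarith
qed

lemma fall_asym:
  fixes p q :: real
  assumes "p + q = 1" "0 \<le> p" "p \<le> q"
  shows "fall p m \<le> fall q m"
proof (cases "2 \<le> m")
  case True
  then obtain j where m: "m = j + 2" by (metis le_add_diff_inverse2)
  have pq: "1 - p = q" "1 - q = p" using assms(1) by auto
  have "fall q m - fall p m = real m * (p * q) * (q ^ j - p ^ j)"
    unfolding fall_def pq by (simp add: m algebra_simps)
  also have "\<dots> \<ge> 0"
    using assms by (intro mult_nonneg_nonneg) (auto intro: power_mono)
  finally show ?thesis by simp
qed (simp add: fall_def)

text \<open>Together with \<open>fall_asym\<close> this shows that a very popular channel leaves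
  more weight in every state, and so is the worse choice.\<close>

lemma stay_asym:
  fixes p q :: real
  assumes "p + q = 1" "0 \<le> p" "p \<le> q" "real m * p \<le> q"
  shows "stay p m \<le> stay q m"
proof (cases "2 \<le> m")
  case True
  then obtain j where m: "m = j + 2" by (metis le_add_diff_inverse2)
  have pq: "1 - p = q" "1 - q = p" using assms(1) by auto
  have "stay q m - stay p m = (q\<^sup>2 - real m * p * q) * (q ^ j - p ^ j) + p ^ j * (q\<^sup>2 - p\<^sup>2)"
    unfolding stay_def fall_def pq by (simp add: m power2_eq_square algebra_simps)
  moreover have "0 \<le> (q\<^sup>2 - real m * p * q) * (q ^ j - p ^ j)"
  proof (intro mult_nonneg_nonneg)
    show "0 \<le> q\<^sup>2 - real m * p * q"
      using mult_right_mono[OF assms(4), of q] assms by (simp add: power2_eq_square)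
  qed (use assms in \<open>auto intro: power_mono\<close>)
  moreover have "0 \<le> p ^ j * (q\<^sup>2 - p\<^sup>2)"
    using assms by (intro mult_nonneg_nonneg) (auto intro: power_mono)
  ultimately show ?thesis by linarith
next
  case False
  then have "m = 0 \<or> m = Suc 0" by auto
  then show ?thesis using assms by (auto simp: stay_0 stay_1)
qed

section \<open>Linear evolution of the belief and the cost of a strategy\<close>

datatype mode = Popular | Unpopular | Mixed | Idle

definition step :: "real \<Rightarrow> (nat \<Rightarrow> real) \<Rightarrow> nat \<Rightarrow> real" where
  "step x f m = stay x m * f m + fall x (Suc m) * f (Suc m)"

definition mix :: "real \<Rightarrow> (nat \<Rightarrow> real) \<Rightarrow> nat \<Rightarrow> real" where
  "mix q f m = q * step q f m + (1 - q) * step (1 - q) f m"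

definition idle :: "nat \<Rightarrow> real \<Rightarrow> (nat \<Rightarrow> real) \<Rightarrow> nat \<Rightarrow> real" where
  "idle M q f m' = (\<Sum>m\<le>M. f m * idle_kernel q m m')"

fun advance :: "nat \<Rightarrow> real \<Rightarrow> mode \<Rightarrow> (nat \<Rightarrow> real) \<Rightarrow> nat \<Rightarrow> real" where
  "advance M q Popular = step q"
| "advance M q Unpopular = step (1 - q)"
| "advance M q Mixed = mix q"
| "advance M q Idle = idle M q"

fun state :: "nat \<Rightarrow> (nat \<Rightarrow> real) \<Rightarrow> (nat \<Rightarrow> mode) \<Rightarrow> nat \<Rightarrow> nat \<Rightarrow> real" where
  "state M Q c 0 = (\<lambda>m. of_bool (m = M))"
| "state M Q c (Suc t) = advance M (Q (Suc t)) (c (Suc t)) (state M Q c t)"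

definition mass :: "nat \<Rightarrow> (nat \<Rightarrow> real) \<Rightarrow> real" where
  "mass M f = (\<Sum>m\<le>M. f m)"

text \<open>The tail-sum form of the expected latency; values in \<open>ennreal\<close> give every
  sequence of modes a cost, convergent or not.\<close>

definition cost :: "nat \<Rightarrow> (nat \<Rightarrow> real) \<Rightarrow> (nat \<Rightarrow> mode) \<Rightarrow> ennreal" where
  "cost M Q c = (\<Sum>s. ennreal (mass M (state M Q c s)))"

lemma step_linear: "step x (\<lambda>m. a * f m + b * g m) = (\<lambda>m. a * step x f m + b * step x g m)"
  by (auto simp: step_def algebra_simps)

lemma mix_linear: "mix x (\<lambda>m. a * f m + b * g m) = (\<lambda>m. a * mix x f m + b * mix x g m)"
  by (auto simp: mix_def step_linear algebra_simps)

lemma mass_linear: "mass M (\<lambda>m. a * f m + b * g m) = a * mass M f + b * mass M g"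
  by (simp add: mass_def sum.distrib sum_distrib_left)

text \<open>The bracket on the right is the adjoint of \<open>step x\<close> applied to
  \<open>L\<close>, the expectation of \<open>L\<close> after the slot on the event of staying
  pending. At \<open>m = 0\<close> the truncated \<open>m - 1\<close> is harmless by
  \<open>fall_0\<close>.\<close>

lemma sum_step:
  assumes "\<And>m. M < m \<Longrightarrow> f m = 0"
  shows "(\<Sum>m\<le>M. L m * step x f m) = (\<Sum>m\<le>M. f m * (stay x m * L m + fall x m * L (m - 1)))"
proof -
  have "(\<Sum>m\<le>M. L m * (fall x (Suc m) * f (Suc m))) = (\<Sum>m\<le>Suc M. f m * (fall x m * L (m - 1)))"
    by (subst sum.atMost_Suc_shift) (simp add: fall_0 mult_ac)
  also have "\<dots> = (\<Sum>m\<le>M. f m * (fall x m * L (m - 1)))"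
    using assms by simp
  finally show ?thesis
    by (simp add: step_def sum.distrib algebra_simps)
qed

lemma mass_step:
  assumes "\<And>m. M < m \<Longrightarrow> f m = 0"
  shows "mass M (step x f) = mass M f - (\<Sum>m\<le>M. f m * (1 - x) ^ m)"
proof -
  have "mass M (step x f) = (\<Sum>m\<le>M. f m * (stay x m + fall x m))"
    using sum_step[of M f "\<lambda>_. 1" x, OF assms] by (simp add: mass_def)
  also have "\<dots> = (\<Sum>m\<le>M. f m - f m * (1 - x) ^ m)"
    unfolding stay_plus_fall by (simp add: algebra_simps)
  finally show ?thesis by (simp add: mass_def sum_subtractf)
qed

text \<open>While \<open>x\<close> is negative, a factor of at most 1 does not decrease it, so each
  step adds at least \<open>d\<close> and some value is nonnegative. From then on
  \<open>a s * x s\<close> stays nonnegative and each next value is at least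
  \<open>d\<close>.\<close>

lemma eventually_bounded_below:
  fixes x a :: "nat \<Rightarrow> real"
  assumes "0 < d" and rec: "\<And>s. s0 \<le> s \<Longrightarrow> a s * x s + d \<le> x (Suc s)"
    and a: "\<And>s. s0 \<le> s \<Longrightarrow> 0 \<le> a s" "\<And>s. s0 \<le> s \<Longrightarrow> a s \<le> 1"
  shows "\<exists>s1. \<forall>s\<ge>s1. d \<le> x s"
proof -
  have "\<exists>s\<ge>s0. 0 \<le> x s"
  proof (rule ccontr)
    assume "\<not> ?thesis"
    then have neg: "x s < 0" if "s0 \<le> s" for s using that by (meson not_le)
    have grow: "x s0 + real k * d \<le> x (s0 + k)" for k
    proof (induction k)
      case (Suc k)
      have "1 * x (s0 + k) \<le> a (s0 + k) * x (s0 + k)"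
        using a(2)[of "s0 + k"] neg[of "s0 + k"] by (intro mult_right_mono_neg) auto
      then show ?case using rec[of "s0 + k"] Suc by (simp add: algebra_simps)
    qed simp
    obtain k where "- x s0 < real k * d" using reals_Archimedean3[OF assms(1)] by blast
    then show False using grow[of k] neg[of "s0 + k"] by simp
  qed
  then obtain s1 where s1: "s0 \<le> s1" "0 \<le> x s1" by blast
  have nonneg: "0 \<le> x s" if "s1 \<le> s" for s
    using that
  proof (induction rule: dec_induct)
    case (step n)
    have "0 \<le> a n * x n" using step s1 a(1)[of n] by simp
    then show ?case using rec[of n] step s1 \<open>0 < d\<close> by simp
  qed (rule s1)
  have "d \<le> x (Suc s)" if "s1 \<le> s" for s
  proof -
    have "0 \<le> a s * x s" using that s1 a(1)[of s] nonneg[of s] by simp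
    then show ?thesis using rec[of s] that s1 by simp
  qed
  then show ?thesis by (metis Suc_le_D Suc_le_mono)
qed

section \<open>Optimality of all never-idle sequences\<close>

text \<open>A player who never idles is not left alone: if a single other player succeeds, she does
  so on the other channel and the tagged player succeeds as well. Hence
  \<open>f 0 = 0\<close>.\<close>

definition belief :: "nat \<Rightarrow> (nat \<Rightarrow> real) \<Rightarrow> bool" where
  "belief M f \<longleftrightarrow> f 0 = 0 \<and> (\<forall>m>M. f m = 0)"

definition pure :: "(nat \<Rightarrow> mode) \<Rightarrow> bool" where
  "pure c \<longleftrightarrow> (\<forall>s. c s = Popular \<or> c s = Unpopular)"

definition switch_after :: "(nat \<Rightarrow> mode) \<Rightarrow> nat \<Rightarrow> nat \<Rightarrow> mode" where
  "switch_after c t s = (if s \<le> t then c s else Mixed)"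

lemma step_belief: "belief M f \<Longrightarrow> belief M (step x f)"
  by (simp add: belief_def step_def stay_0 fall_1)

lemma mix_belief: "belief M f \<Longrightarrow> belief M (mix x f)"
  using step_belief[of M f] by (simp add: belief_def mix_def)

lemma step_nonneg:
  "(\<And>m. 0 \<le> f m) \<Longrightarrow> 0 \<le> x \<Longrightarrow> x \<le> 1 \<Longrightarrow> 0 \<le> step x f m"
  by (simp add: step_def stay_nonneg fall_nonneg)

lemma mix_nonneg:
  "(\<And>m. 0 \<le> f m) \<Longrightarrow> 0 \<le> x \<Longrightarrow> x \<le> 1 \<Longrightarrow> 0 \<le> mix x f m"
  by (simp add: mix_def step_nonneg)

lemma state_cong:
  "(\<And>s. s \<le> t \<Longrightarrow> c s = c' s) \<Longrightarrow> state M Q c t = state M Q c' t"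
  by (induction t) auto

lemma pure_upd: "pure c \<Longrightarrow> x = Popular \<or> x = Unpopular \<Longrightarrow> pure (c(t := x))"
  by (auto simp: pure_def)

text \<open>Unlike \<open>state\<close>, this starts from an arbitrary vector, possibly signed, so
  that the future cost after slot \<open>t\<close> becomes a linear functional.\<close>

fun evolve :: "(nat \<Rightarrow> real) \<Rightarrow> nat \<Rightarrow> (nat \<Rightarrow> real) \<Rightarrow> nat \<Rightarrow> nat \<Rightarrow> real" where
  "evolve Q t f 0 = f"
| "evolve Q t f (Suc s) = mix (Q (Suc (t + s))) (evolve Q t f s)"

definition tail :: "nat \<Rightarrow> (nat \<Rightarrow> real) \<Rightarrow> nat \<Rightarrow> (nat \<Rightarrow> real) \<Rightarrow> nat \<Rightarrow> real" where
  "tail M Q t f s = mass M (evolve Q t f s)"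

lemma evolve_linear: "evolve Q t (\<lambda>m. a * f m + b * g m) s
    = (\<lambda>m. a * evolve Q t f s m + b * evolve Q t g s m)"
  by (induction s) (simp_all add: mix_linear)

lemma tail_linear:
  "tail M Q t (\<lambda>m. a * f m + b * g m) s = a * tail M Q t f s + b * tail M Q t g s"
  by (simp add: tail_def evolve_linear mass_linear)

lemma evolve_shift: "evolve Q t f (Suc s) = evolve Q (Suc t) (mix (Q (Suc t)) f) s"
  by (induction s) simp_all

lemma state_add:
  "(\<And>s. t < s \<Longrightarrow> c s = Mixed) \<Longrightarrow> state M Q c (t + s) = evolve Q t (state M Q c t) s"
  by (induction s) simp_all

lemma state_switch_after: "state M Q (switch_after c t) t = state M Q c t"
  by (rule state_cong) (simp add: switch_after_def)

lemma state_switch_after_add: "state M Q (switch_after c t) (t + s) = evolve Q t (state M Q c t) s"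
  by (subst state_add) (simp_all add: switch_after_def[of _ _ "_ :: nat"] state_switch_after)

lemma state_switch_after_le: "s \<le> t \<Longrightarrow> state M Q (switch_after c t) s = state M Q c s"
  by (rule state_cong) (simp add: switch_after_def)

text \<open>\<open>M\<close> counts the other players. Of the equilibrium condition
  \<open>opt\<close> keeps the comparison at slot 1 with deviations planned in advance, one mode per
  slot.\<close>

locale contention =
  fixes M :: nat and Q :: "nat \<Rightarrow> real"
  assumes M: "4 \<le> M" and Q_ge: "\<And>t. 1 / 2 \<le> Q t" and Q_le: "\<And>t. Q t \<le> 1"
    and opt: "\<And>c. cost M Q (\<lambda>_. Mixed) \<le> cost M Q c"
begin

lemma Q_bounds: "0 \<le> Q t" "0 < Q t" "0 \<le> 1 - Q t" "1 - Q t \<le> 1" "1 - Q t \<le> 1 / 2" "1 - Q t \<le> Q t"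
  using Q_ge[of t] Q_le[of t] by auto

lemma state_belief: "(\<And>s. c s \<noteq> Idle) \<Longrightarrow> belief M (state M Q c t)"
proof (induction t)
  case 0
  then show ?case using M by (simp add: belief_def)
next
  case (Suc t)
  then show ?case by (cases "c (Suc t)") (auto intro: step_belief mix_belief)
qed

lemma state_nonneg: "(\<And>s. c s \<noteq> Idle) \<Longrightarrow> 0 \<le> state M Q c t m"
proof (induction t arbitrary: m)
  case (Suc t)
  then show ?case
    using Q_bounds[of "Suc t"] Q_le[of "Suc t"]
    by (cases "c (Suc t)") (auto intro!: step_nonneg mix_nonneg)
qed simp

lemma evolve_nonneg: "(\<And>m. 0 \<le> f m) \<Longrightarrow> 0 \<le> evolve Q t f s m"
  using Q_bounds Q_le by (induction s arbitrary: m) (auto intro!: mix_nonneg)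

lemma tail_nonneg: "(\<And>m. 0 \<le> f m) \<Longrightarrow> 0 \<le> tail M Q t f s"
  unfolding tail_def mass_def by (intro sum_nonneg evolve_nonneg)

lemma mass_nonneg: "(\<And>s. c s \<noteq> Idle) \<Longrightarrow> 0 \<le> mass M (state M Q c t)"
  unfolding mass_def by (intro sum_nonneg state_nonneg)

lemma pure_not_Idle: "pure c \<Longrightarrow> c s \<noteq> Idle" "pure c \<Longrightarrow> switch_after c t s \<noteq> Idle"
  unfolding pure_def switch_after_def by (metis mode.distinct(5,9), metis mode.distinct)

text \<open>Always using the unpopular channel succeeds in each slot with conditional probability at
  least \<open>(1/2) ^ M\<close>, so its cost is bounded by a geometric series, and
  \<open>opt\<close> carries this over to the protocol.\<close>

lemma cost_finite: "cost M Q (\<lambda>_. Mixed) < \<top>"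
proof -
  let ?r = "1 - (1/2 :: real) ^ M"
  have r: "0 \<le> ?r" "?r < 1" by (simp_all add: power_le_one)
  have mass: "mass M (state M Q (\<lambda>_. Unpopular) t) \<le> ?r ^ t" for t
  proof (induction t)
    case 0
    then show ?case by (simp add: mass_def)
  next
    case (Suc t)
    let ?f = "state M Q (\<lambda>_. Unpopular) t"
    have f: "belief M ?f" "\<And>m. 0 \<le> ?f m" by (auto intro: state_belief state_nonneg)
    have "(1/2) ^ M * mass M ?f = (\<Sum>m\<le>M. ?f m * (1/2) ^ M)"
      by (simp add: mass_def sum_distrib_left mult.commute)
    also have "\<dots> \<le> (\<Sum>m\<le>M. ?f m * (1 - (1 - Q (Suc t))) ^ m)"
    proof (intro sum_mono mult_left_mono f)
      fix m assume "m \<in> {..M}"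
      then have "(1/2 :: real) ^ M \<le> (1/2) ^ m" by (intro power_decreasing) auto
      also have "\<dots> \<le> Q (Suc t) ^ m" using Q_ge[of "Suc t"] by (intro power_mono) auto
      finally show "(1/2) ^ M \<le> (1 - (1 - Q (Suc t))) ^ m" by simp
    qed
    finally have "mass M (state M Q (\<lambda>_. Unpopular) (Suc t)) \<le> ?r * mass M ?f"
      using mass_step[of M ?f "1 - Q (Suc t)"] f(1) by (simp add: belief_def algebra_simps)
    also have "\<dots> \<le> ?r * ?r ^ t" using Suc r by (intro mult_left_mono)
    finally show ?case by simp
  qed
  have "cost M Q (\<lambda>_. Mixed) \<le> cost M Q (\<lambda>_. Unpopular)" by (rule opt)
  also have "\<dots> \<le> (\<Sum>t. ennreal (?r ^ t))"
    unfolding cost_def by (intro suminf_le ennreal_leI mass) auto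
  also have "\<dots> = ennreal (\<Sum>t. ?r ^ t)"
    using r by (intro suminf_ennreal2) (auto intro: summable_geometric)
  also have "\<dots> < \<top>" by simp
  finally show ?thesis .
qed

definition C :: real where "C = (\<Sum>s. mass M (state M Q (\<lambda>_. Mixed) s))"

lemma Mixed_sums: "(\<lambda>s. mass M (state M Q (\<lambda>_. Mixed) s)) sums C"
  and cost_Mixed: "cost M Q (\<lambda>_. Mixed) = ennreal C"
proof -
  have nn: "0 \<le> mass M (state M Q (\<lambda>_. Mixed) s)" for s by (rule mass_nonneg) simp
  have sm: "summable (\<lambda>s. mass M (state M Q (\<lambda>_. Mixed) s))"
    using cost_finite nn unfolding cost_def by (intro summable_suminf_not_top) auto
  then show "(\<lambda>s. mass M (state M Q (\<lambda>_. Mixed) s)) sums C" unfolding C_def by (rule summable_sums)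
  show "cost M Q (\<lambda>_. Mixed) = ennreal C"
    unfolding cost_def C_def by (intro suminf_ennreal2 nn sm)
qed

lemma C_le:
  assumes "(\<lambda>s. mass M (state M Q c s)) sums D" "\<And>s. 0 \<le> mass M (state M Q c s)"
  shows "C \<le> D"
proof -
  have "cost M Q c = ennreal (\<Sum>s. mass M (state M Q c s))"
    unfolding cost_def using assms by (intro suminf_ennreal2) (auto simp: sums_iff)
  then have "ennreal C \<le> ennreal D"
    using opt[of c] assms(1) by (simp add: cost_Mixed sums_iff)
  moreover have "0 \<le> D" using assms suminf_nonneg by (metis sums_iff)
  ultimately show ?thesis by simp
qed

abbreviation optimal :: "(nat \<Rightarrow> mode) \<Rightarrow> nat \<Rightarrow> bool" where
  "optimal c t \<equiv> (\<lambda>s. mass M (state M Q (switch_after c t) s)) sums C"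

text \<open>Conditioning on the channel used in slot \<open>t + 1\<close>, the first slot in which
  the protocol is followed.\<close>

lemma mass_switch_split:
  "mass M (state M Q (switch_after c t) s)
    = Q (Suc t) * mass M (state M Q (switch_after (c(Suc t := Popular)) (Suc t)) s)
      + (1 - Q (Suc t)) * mass M (state M Q (switch_after (c(Suc t := Unpopular)) (Suc t)) s)"
proof (cases "s \<le> t")
  case True
  have "state M Q (switch_after c t) s = state M Q c s"
    "state M Q (switch_after (c(Suc t := x)) (Suc t)) s = state M Q c s" for x
    using True by (auto intro!: state_cong simp: switch_after_def)
  then show ?thesis by (simp add: algebra_simps)
next
  case False
  then obtain j where s: "s = Suc t + j" by (metis less_iff_Suc_add not_le add_Suc)
  have eq: "state M Q (c(Suc t := x)) t = state M Q c t" for x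
    by (rule state_cong) simp
  have "state M Q (switch_after c t) s = evolve Q (Suc t) (mix (Q (Suc t)) (state M Q c t)) j"
    unfolding s add_Suc add_Suc_right[symmetric] state_switch_after_add by (rule evolve_shift)
  moreover have "mix (Q (Suc t)) (state M Q c t) = (\<lambda>m. Q (Suc t) * step (Q (Suc t)) (state M Q c t) m
      + (1 - Q (Suc t)) * step (1 - Q (Suc t)) (state M Q c t) m)"
    by (simp add: mix_def fun_eq_iff)
  ultimately show ?thesis
    unfolding s state_switch_after_add by (simp add: evolve_linear mass_linear eq)
qed

text \<open>The assumed bound makes both channels carry positive probability, so with either choice
  there is a positive chance that nobody succeeds in the slot.\<close>

lemma state_top_pos:
  assumes "pure c" "\<And>s. 1 \<le> s \<Longrightarrow> s \<le> t \<Longrightarrow> Q s < real M * (1 - Q s)"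
  shows "0 < state M Q c t M"
  using assms(2)
proof (induction t)
  case (Suc t)
  let ?f = "state M Q c t"
  have f: "0 < ?f M" "?f (Suc M) = 0"
    using Suc state_belief[of c t] pure_not_Idle[OF assms(1)] by (auto simp: belief_def)
  have "0 < 1 - Q (Suc t)"
    using Suc.prems[of "Suc t"] Q_bounds[of "Suc t"] by (cases "1 - Q (Suc t) = 0") auto
  then have "0 < stay (Q (Suc t)) M" "0 < stay (1 - Q (Suc t)) M"
    using Q_bounds[of "Suc t"] Q_le[of "Suc t"] M by (auto intro!: stay_pos)
  moreover have "c (Suc t) = Popular \<or> c (Suc t) = Unpopular"
    using assms(1) by (simp add: pure_def)
  ultimately show ?case using f by (auto simp: step_def)
qed simp

text \<open>An average equal to \<open>C\<close> of two costs, each at least \<open>C\<close>,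
  forces equality wherever the weight is positive. The popular weight is at least
  \<open>1/2\<close>. The unpopular weight is positive by the third claim, since otherwise the
  unpopular choice would cost strictly less than \<open>C\<close>.\<close>

lemma optimal_step:
  assumes pc: "pure c" and "optimal c t"
    and low: "\<And>s. 1 \<le> s \<Longrightarrow> s \<le> t \<Longrightarrow> Q s < real M * (1 - Q s)"
  shows "optimal (c(Suc t := Popular)) (Suc t)" "optimal (c(Suc t := Unpopular)) (Suc t)"
    "Q (Suc t) < real M * (1 - Q (Suc t))"
proof -
  let ?q = "Q (Suc t)" and ?p = "1 - Q (Suc t)"
  let ?c1 = "switch_after (c(Suc t := Popular)) (Suc t)" and ?c2 = "switch_after (c(Suc t := Unpopular)) (Suc t)"
  define a where "a = (\<lambda>s. mass M (state M Q ?c1 s))"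
  define b where "b = (\<lambda>s. mass M (state M Q ?c2 s))"
  have nn: "0 \<le> a s" "0 \<le> b s" for s
    unfolding a_def b_def using pc by (auto intro!: mass_nonneg pure_not_Idle pure_upd)
  have split: "(\<lambda>s. ?q * a s + ?p * b s) sums C"
    using assms(2) unfolding a_def b_def by (subst (asm) mass_switch_split)
  have q: "1/2 \<le> ?q" "0 \<le> ?p" using Q_ge Q_bounds by auto
  have "summable a"
  \<comment> \<open>The popular weight is at least \<open>1/2\<close>, so \<open>a\<close> is
    dominated by twice the average.\<close>
  proof (rule summable_comparison_test')
    show "summable (\<lambda>s. 2 * (?q * a s + ?p * b s))" using split by (intro summable_mult) (simp add: sums_iff)
    show "norm (a s) \<le> 2 * (?q * a s + ?p * b s)" for s
    proof -
      have "(1/2) * a s \<le> ?q * a s" "0 \<le> ?p * b s"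
        using nn q by (intro mult_right_mono mult_nonneg_nonneg; simp)+
      then show ?thesis using nn[of s] by simp
    qed
  qed
  then have A: "a sums suminf a" by (rule summable_sums)
  have CA: "C \<le> suminf a" using A nn unfolding a_def by (intro C_le)
  have both: "suminf a = C \<and> b sums C" if p: "0 < ?p"
  proof -
    have "summable (\<lambda>s. (1 / ?p) * ((?q * a s + ?p * b s) - ?q * a s))"
      using split A by (intro summable_mult summable_diff) (auto simp: sums_iff)
    then have "summable b" using p by simp
    then have B: "b sums suminf b" by (rule summable_sums)
    have CB: "C \<le> suminf b" using B nn unfolding b_def by (intro C_le)
    have "C = ?q * suminf a + ?p * suminf b"
      using split sums_add[OF sums_mult[OF A] sums_mult[OF B]] by (rule sums_unique2)
    then have "?q * (suminf a - C) + ?p * (suminf b - C) = 0"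
      by (simp add: algebra_simps)
    moreover have "0 \<le> ?q * (suminf a - C)" "0 \<le> ?p * (suminf b - C)" using q CA CB by auto
    ultimately have "?q * (suminf a - C) = 0" "?p * (suminf b - C) = 0" by linarith+
    then show ?thesis using q p B by auto
  qed
  have AC: "suminf a = C"
  proof (cases "?p = 0")
    case True
    then show ?thesis using split A by (simp add: sums_iff)
  next
    case False
    then show ?thesis using both q by simp
  qed
  show low': "?q < real M * ?p"
  proof (rule ccontr)
    assume "\<not> ?q < real M * ?p"
    then have big: "real M * ?p \<le> ?q" by simp
    let ?G = "state M Q c t"
    have G: "belief M ?G" "\<And>m. 0 \<le> ?G m" "0 < ?G M"
      using state_belief[of c t] state_nonneg[of c t] pure_not_Idle[OF pc] state_top_pos[OF pc low] by auto
    \<comment> \<open>The costs of the two choices differ by the future cost of \<open>D\<close>,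
      and \<open>D\<close> is nonnegative in every state when \<open>M * p \<le> q\<close>.\<close>
    define D where "D = (\<lambda>m. 1 * step ?q ?G m + (-1) * step ?p ?G m)"
    have D: "0 \<le> D m" for m
    proof (cases "m \<le> M")
      case True
      then have "real m * ?p \<le> ?q" using big q mult_right_mono[of "real m" "real M" ?p] by simp
      then have "stay ?p m \<le> stay ?q m" "fall ?p (Suc m) \<le> fall ?q (Suc m)"
        using q by (auto intro!: stay_asym fall_asym)
      then have "stay ?p m * ?G m \<le> stay ?q m * ?G m"
        "fall ?p (Suc m) * ?G (Suc m) \<le> fall ?q (Suc m) * ?G (Suc m)"
        using G by (auto intro!: mult_right_mono)
      then show ?thesis by (simp add: D_def step_def)
    next
      case False
      then show ?thesis using G by (simp add: D_def step_def belief_def)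
    qed
    have eq: "state M Q (c(Suc t := x)) t = ?G" for x by (rule state_cong) simp
    have le: "s \<le> t \<Longrightarrow> a s = b s" for s
      unfolding a_def b_def by (auto intro!: arg_cong[where f = "mass M"] state_cong simp: switch_after_def)
    have late: "a (Suc t + j) - b (Suc t + j) = tail M Q (Suc t) D j" for j
      unfolding a_def b_def state_switch_after_add D_def tail_linear by (simp add: eq tail_def)
    have ab: "0 \<le> a s - b s" for s
    proof (cases "s \<le> t")
      case False
      then obtain j where "s = Suc t + j" by (metis less_iff_Suc_add not_le add_Suc)
      then show ?thesis using late[of j] tail_nonneg[OF D] by simp
    qed (simp add: le)
    have "4 * ?p \<le> real M * ?p" using M q by (intro mult_right_mono) auto
    then have "4 * ?p \<le> ?q" using big by (rule order_trans)
    then have pq: "?p < ?q" using q(1) by (simp add: algebra_simps)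
    \<comment> \<open>With \<open>m\<close> others pending, the success probability in this slot is
      \<open>p ^ m\<close> on the popular channel and \<open>q ^ m\<close> on the unpopular
      one.\<close>
    have "mass M D = (\<Sum>m\<le>M. ?G m * (?q ^ m - ?p ^ m))"
      unfolding D_def mass_linear using G(1)
      by (simp add: mass_step belief_def algebra_simps sum_subtractf)
    also have "\<dots> > 0"
    proof (rule sum_pos2[of _ M])
      show "0 < ?G M * (?q ^ M - ?p ^ M)"
        using G(3) pq q M by (auto intro!: mult_pos_pos power_strict_mono)
      show "0 \<le> ?G m * (?q ^ m - ?p ^ m)" for m
        using G(2) pq q by (auto intro!: mult_nonneg_nonneg power_mono)
    qed auto
    finally have "0 < a (Suc t) - b (Suc t)"
      using late[of 0] by (simp add: tail_def)
    moreover have "summable b"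
      using ab nn by (intro summable_comparison_test'[OF \<open>summable a\<close>, of 0]) auto
    ultimately have "0 < (\<Sum>s. a s - b s)"
      using ab \<open>summable a\<close> by (intro suminf_pos2[of _ "Suc t"] summable_diff) auto
    then have "suminf b < C"
      using AC \<open>summable a\<close> \<open>summable b\<close> by (simp add: suminf_diff[symmetric])
    moreover have "C \<le> suminf b"
      using summable_sums[OF \<open>summable b\<close>] nn unfolding b_def by (intro C_le)
    ultimately show False by simp
  qed
  show "optimal (c(Suc t := Popular)) (Suc t)" using A AC unfolding a_def by simp
  have "0 < ?p" using low' q by (cases "?p = 0") auto
  then show "optimal (c(Suc t := Unpopular)) (Suc t)" using both unfolding b_def by simp
qed

text \<open>The claims need each other: the bounds up to \<open>t\<close> keep state
  \<open>M\<close> reachable, with optimality at \<open>t\<close> this yields the bound for slot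
  \<open>t + 1\<close>, and that bound makes both channels of slot \<open>t + 1\<close>
  optimal.\<close>

lemma optimal_and_low:
  "(\<forall>s. 1 \<le> s \<and> s \<le> t \<longrightarrow> Q s < real M * (1 - Q s)) \<and> (\<forall>c. pure c \<longrightarrow> optimal c t)"
proof (induction t)
  case 0
  have "state M Q (switch_after c 0) s = state M Q (\<lambda>_. Mixed) s" for c s
  proof (induction s)
    case (Suc s) then show ?case by (simp add: switch_after_def)
  qed simp
  then show ?case using Mixed_sums by simp
next
  case (Suc t)
  have "pure (\<lambda>_. Popular)" by (simp add: pure_def)
  then have low: "Q (Suc t) < real M * (1 - Q (Suc t))" using optimal_step(3) Suc by blast
  have "optimal c (Suc t)" if c: "pure c" for c
  proof -
    have "optimal (c(Suc t := c (Suc t))) (Suc t)"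
      using optimal_step(1,2)[OF c, of t] Suc c unfolding pure_def by metis
    then show ?thesis by simp
  qed
  with Suc low show ?case by (auto simp: le_Suc_eq)
qed

lemma Q_lt: "1 \<le> t \<Longrightarrow> Q t < real M * (1 - Q t)"
  using optimal_and_low[of t] by blast

lemma optimal: "pure c \<Longrightarrow> optimal c t"
  using optimal_and_low[of t] by blast

end

section \<open>The protocol is eventually fair\<close>

definition has_degree :: "(nat \<Rightarrow> real) \<Rightarrow> nat \<Rightarrow> bool" where
  "has_degree f k \<longleftrightarrow> f k \<noteq> 0 \<and> (\<forall>m>k. f m = 0)"

lemma has_degree_exists:
  assumes "f \<noteq> (\<lambda>_. 0)" "\<And>m. k \<le> m \<Longrightarrow> f m = 0"
  shows "\<exists>j<k. has_degree f j"
proof -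
  let ?S = "{m. f m \<noteq> 0}"
  have S: "?S \<subseteq> {..<k}" using assms(2) by (auto simp: not_le[symmetric])
  then have fin: "finite ?S" by (rule finite_subset) simp
  moreover have "?S \<noteq> {}" using assms(1) by auto
  ultimately have "Max ?S \<in> ?S" by (rule Max_in)
  moreover have "f m = 0" if "Max ?S < m" for m
  proof (rule ccontr)
    assume "f m \<noteq> 0"
    then have "m \<le> Max ?S" by (intro Max_ge[OF fin]) simp
    then show False using that by linarith
  qed
  moreover have "Max ?S < k" using S \<open>Max ?S \<in> ?S\<close> by blast
  ultimately show ?thesis unfolding has_degree_def by blast
qed

lemma nonneg_sums_0:
  fixes f :: "nat \<Rightarrow> real"
  assumes "f sums 0" "\<And>n. 0 \<le> f n"
  shows "f n = 0"
  using suminf_eq_zero_iff[of f] assms by (simp add: sums_iff)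

context contention begin

text \<open>Every reachable belief has degree \<open>M\<close>; signed combinations are what brings
  lower degrees into play.\<close>

inductive reach_span :: "nat \<Rightarrow> (nat \<Rightarrow> real) \<Rightarrow> bool" where
  base: "pure c \<Longrightarrow> reach_span t (state M Q c t)"
| comb: "reach_span t f \<Longrightarrow> reach_span t g \<Longrightarrow> reach_span t (\<lambda>m. a * f m + b * g m)"

lemma reach_span_belief: "reach_span t f \<Longrightarrow> belief M f"
proof (induction rule: reach_span.induct)
  case (base c t)
  then show ?case using pure_not_Idle by (auto intro: state_belief)
qed (simp add: belief_def)

lemma reach_span_step:
  assumes "reach_span t f"
  shows "reach_span (Suc t) (step (Q (Suc t)) f)" "reach_span (Suc t) (step (1 - Q (Suc t)) f)"
  using assms
proof (induction rule: reach_span.induct)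
  case (base c t)
  have eq: "state M Q (c(Suc t := x)) t = state M Q c t" for x by (rule state_cong) simp
  {
    case 1
    show ?case using reach_span.base[OF pure_upd[OF base, of Popular "Suc t"], of "Suc t"] by (simp add: eq)
  next
    case 2
    show ?case using reach_span.base[OF pure_upd[OF base, of Unpopular "Suc t"], of "Suc t"] by (simp add: eq)
  }
qed (auto simp: step_linear intro: reach_span.comb)

text \<open>Both channels of slot \<open>t + 1\<close> are optimal with total \<open>C\<close>, and
  the masses before that slot's outcome agree. Hence the remainders agree, and linearity extends
  this to the span.\<close>

lemma tail_step_sums:
  assumes "reach_span t f"
  shows "\<exists>W. tail M Q (Suc t) (step (Q (Suc t)) f) sums W \<and> tail M Q (Suc t) (step (1 - Q (Suc t)) f) sums W"
  using assms
proof (induction rule: reach_span.induct)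
  case (base c t)
  let ?W = "C - (\<Sum>s<Suc t. mass M (state M Q c s))"
  have "tail M Q (Suc t) (advance M (Q (Suc t)) x (state M Q c t)) sums ?W"
    if x: "x = Popular \<or> x = Unpopular" for x
  proof -
    let ?c = "c(Suc t := x)"
    have opt: "optimal ?c (Suc t)" by (rule optimal[OF pure_upd[OF base x]])
    have "state M Q (switch_after ?c (Suc t)) s = state M Q c s" if "s < Suc t" for s
      using that by (intro state_cong) (simp add: switch_after_def)
    moreover have "mass M (state M Q (switch_after ?c (Suc t)) (s + Suc t))
        = tail M Q (Suc t) (advance M (Q (Suc t)) x (state M Q c t)) s" for s
    proof -
      have eq: "state M Q ?c t = state M Q c t" by (rule state_cong) simp
      show ?thesis
        unfolding add.commute[of s] state_switch_after_add tail_def by (simp add: eq)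
    qed
    ultimately show ?thesis
      using sums_split_initial_segment[OF opt, of "Suc t"] by simp
  qed
  from this[of Popular] this[of Unpopular] show ?case by auto
next
  case (comb t f g a b)
  then obtain W V where
    "tail M Q (Suc t) (step (Q (Suc t)) f) sums W" "tail M Q (Suc t) (step (1 - Q (Suc t)) f) sums W"
    "tail M Q (Suc t) (step (Q (Suc t)) g) sums V" "tail M Q (Suc t) (step (1 - Q (Suc t)) g) sums V"
    by blast
  then show ?case
    by (intro exI[of _ "a * W + b * V"])
      (auto simp: step_linear tail_linear[abs_def] intro!: sums_add sums_mult)
qed

lemma tail_diff_sums:
  assumes "reach_span t f"
  shows "tail M Q (Suc t) (\<lambda>m. step (Q (Suc t)) f m - step (1 - Q (Suc t)) f m) sums 0"
proof -
  obtain W where "tail M Q (Suc t) (step (Q (Suc t)) f) sums W" "tail M Q (Suc t) (step (1 - Q (Suc t)) f) sums W"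
    using tail_step_sums[OF assms] by blast
  from sums_diff[OF this] show ?thesis
    using tail_linear[of M Q "Suc t" 1 "step (Q (Suc t)) f" "-1" "step (1 - Q (Suc t)) f", abs_def]
    by (simp add: fun_eq_iff)
qed

section \<open>The minimal degree in the span of the reachable beliefs\<close>

definition min_degree :: "nat \<Rightarrow> nat" where
  "min_degree t = (LEAST k. \<exists>f. reach_span t f \<and> has_degree f k)"

lemma unpopular_pos: "1 \<le> t \<Longrightarrow> 0 < 1 - Q t"
  using Q_lt[of t] Q_bounds[of t] by (cases "1 - Q t = 0") auto

lemma min_degree_attained: "\<exists>f. reach_span t f \<and> has_degree f (min_degree t)"
proof -
  let ?c = "\<lambda>_. Popular"
  have c: "pure ?c" by (simp add: pure_def)
  have "has_degree (state M Q ?c t) M"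
    using state_top_pos[OF c, of t] Q_lt state_belief[of ?c t] by (force simp: has_degree_def belief_def)
  then have "\<exists>f. reach_span t f \<and> has_degree f M" using reach_span.base[OF c] by blast
  then show ?thesis unfolding min_degree_def by (rule LeastI)
qed

lemma min_degree_le: "reach_span t f \<Longrightarrow> has_degree f k \<Longrightarrow> min_degree t \<le> k"
  unfolding min_degree_def by (rule Least_le) blast

lemma reach_span_degree_pos: "reach_span t f \<Longrightarrow> has_degree f k \<Longrightarrow> 1 \<le> k"
  using reach_span_belief[of t f] by (cases k) (auto simp: has_degree_def belief_def)

lemma stay_unpopular_pos: "1 \<le> t \<Longrightarrow> 1 \<le> m \<Longrightarrow> 0 < stay (1 - Q t) m"
  using unpopular_pos[of t] Q_bounds[of t] by (intro stay_pos) auto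

lemma stay_popular_pos: "1 \<le> m \<Longrightarrow> 0 < stay (Q t) m"
  using Q_bounds[of t] Q_le[of t] by (intro stay_pos) auto

text \<open>\<open>step\<close> is triangular: it moves weight to lower indices only and multiplies
  the leading coefficient by a positive \<open>stay\<close>, so degrees are preserved.\<close>

lemma min_degree_Suc: "min_degree (Suc t) \<le> min_degree t"
proof -
  obtain f where f: "reach_span t f" "has_degree f (min_degree t)"
    using min_degree_attained by blast
  have "has_degree (step (1 - Q (Suc t)) f) (min_degree t)"
    using f(2) stay_unpopular_pos[of "Suc t" "min_degree t"] reach_span_degree_pos[OF f]
    by (auto simp: has_degree_def step_def)
  with reach_span_step(2)[OF f(1)] show ?thesis by (rule min_degree_le)
qed

lemma min_degree_stable: "\<exists>T. \<forall>t\<ge>T. min_degree t = min_degree T"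
proof -
  obtain T where T: "\<And>t. min_degree T \<le> min_degree t"
    using ex_has_least_nat[of "\<lambda>_. True" _ min_degree] by blast
  have "min_degree t \<le> min_degree T" if "T \<le> t" for t
    using that
  proof (induction rule: dec_induct)
    case (step n)
    then show ?case using min_degree_Suc[of n] by simp
  qed simp
  with T show ?thesis by (meson le_antisym)
qed

text \<open>Below the stable minimal degree an element of the span vanishes, so both channels act in the
  same way, up to a scalar, on the monic element of minimal degree.\<close>

lemma minimal_elements:
  obtains T k F where "1 \<le> k"
    "\<And>s. reach_span (T + s) (F s)" "\<And>s. F s k = 1" "\<And>s m. k < m \<Longrightarrow> F s m = 0"
    "\<And>s m. F (Suc s) m * stay (Q (Suc (T + s))) k = step (Q (Suc (T + s))) (F s) m"
    "\<And>s m. F (Suc s) m * stay (1 - Q (Suc (T + s))) k = step (1 - Q (Suc (T + s))) (F s) m"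
proof -
  obtain T where T: "\<And>t. T \<le> t \<Longrightarrow> min_degree t = min_degree T"
    using min_degree_stable by blast
  define k where "k = min_degree T"
  obtain f where f: "reach_span T f" "has_degree f k"
    unfolding k_def using min_degree_attained by blast
  have k: "1 \<le> k" by (rule reach_span_degree_pos[OF f])
  \<comment> \<open>The unpopular channel drives the sequence; dividing by \<open>stay\<close> keeps
    the leading coefficient equal to 1.\<close>
  define F where "F = rec_nat (\<lambda>m. f m / f k)
    (\<lambda>s g m. step (1 - Q (Suc (T + s))) g m / stay (1 - Q (Suc (T + s))) k)"
  have F0: "F 0 = (\<lambda>m. f m / f k)" and
    FS: "F (Suc s) = (\<lambda>m. step (1 - Q (Suc (T + s))) (F s) m / stay (1 - Q (Suc (T + s))) k)" for s
    by (simp_all add: F_def)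
  have scale: "reach_span t (\<lambda>m. g m / a)" if "reach_span t g" for t g a
    using reach_span.comb[OF that that, of "1 / a" 0] by simp
  have pos: "0 < stay (1 - Q (Suc (T + s))) k" "0 < stay (Q (Suc (T + s))) k" for s
    using stay_unpopular_pos[of "Suc (T + s)" k] stay_popular_pos[of k "Suc (T + s)"] k by auto
  have F: "reach_span (T + s) (F s) \<and> F s k = 1 \<and> (\<forall>m>k. F s m = 0)" for s
  proof (induction s)
    case 0
    then show ?case using f scale[OF f(1)] by (simp add: F0 has_degree_def)
  next
    case (Suc s)
    then have "reach_span (Suc (T + s)) (F (Suc s))"
      unfolding FS by (intro scale reach_span_step) simp
    moreover have "F (Suc s) k = 1" "\<forall>m>k. F (Suc s) m = 0"
      using Suc pos(1)[of s] by (auto simp: FS step_def)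
    ultimately show ?case by simp
  qed
  have unpop: "F (Suc s) m * stay (1 - Q (Suc (T + s))) k = step (1 - Q (Suc (T + s))) (F s) m" for s m
    using pos(1)[of s] by (simp add: FS)
  have "F (Suc s) m * stay (Q (Suc (T + s))) k = step (Q (Suc (T + s))) (F s) m" for s m
  proof -
    \<comment> \<open>\<open>?D\<close> compares the same sequence with a step on the popular
      channel. It lies in the span and its coefficient at \<open>k\<close> cancels, so by minimality
      of \<open>k\<close> it is zero.\<close>
    let ?D = "\<lambda>m. stay (Q (Suc (T + s))) k * F (Suc s) m + (-1) * step (Q (Suc (T + s))) (F s) m"
    have "reach_span (Suc (T + s)) ?D"
      using F[of s] F[of "Suc s"] by (intro reach_span.comb reach_span_step(1)) auto
    moreover have "?D m = 0" if "k \<le> m" for m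
      using F[of s] F[of "Suc s"] that by (cases "m = k") (auto simp: step_def)
    moreover have "k \<le> j" if "reach_span (Suc (T + s)) g" "has_degree g j" for g j
      using min_degree_le[OF that] T[of "Suc (T + s)"] by (simp add: k_def)
    ultimately have "?D = (\<lambda>_. 0)"
      using has_degree_exists[of ?D k] by (meson not_le)
    then have "?D m = 0" by (rule fun_cong)
    then show ?thesis by (simp add: mult.commute)
  qed
  with that[of k T F] k F unpop show thesis by blast
qed

lemma eventually_symmetric: "\<exists>T. \<forall>t\<ge>T. Q t = 1 / 2"
proof (rule ccontr)
  assume not_sym: "\<nexists>T. \<forall>t\<ge>T. Q t = 1 / 2"
  have inf: "\<exists>t\<ge>T. 1 / 2 < Q t" for T
  proof -
    obtain t where "T \<le> t" "Q t \<noteq> 1 / 2" using not_sym by blast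
    then show ?thesis using Q_ge[of t] by (intro exI[of _ t]) simp
  qed
  obtain T k F where k: "1 \<le> k" and F: "\<And>s. reach_span (T + s) (F s)"
    and mon: "\<And>s. F s k = 1" "\<And>s m. k < m \<Longrightarrow> F s m = 0"
    and pop: "\<And>s m. F (Suc s) m * stay (Q (Suc (T + s))) k = step (Q (Suc (T + s))) (F s) m"
    and unpop: "\<And>s m. F (Suc s) m * stay (1 - Q (Suc (T + s))) k = step (1 - Q (Suc (T + s))) (F s) m"
    by (rule minimal_elements, rule that)
  have asym: "\<exists>s\<ge>s0. 1 / 2 < Q (Suc (T + s))" for s0
  proof -
    obtain t where t: "Suc (T + s0) \<le> t" "1 / 2 < Q t" using inf by blast
    then obtain j where "t = Suc (T + s0) + j" using le_Suc_ex by blast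
    then show ?thesis using t by (intro exI[of _ "s0 + j"]) (simp add: add.assoc)
  qed
  have zero: "F s 0 = 0" for s using reach_span_belief[OF F] by (simp add: belief_def)
  consider "k = 1" | "k = 2" | "3 \<le> k" using k by linarith
  then show False
  proof cases
    \<comment> \<open>Here \<open>F s\<close> is the unit vector at 1, on which
      \<open>step x\<close> is multiplication by \<open>x\<close>. The difference of the channels is
      a positive multiple of a vector of positive cost, yet its cost is 0.\<close>
    case 1
    obtain s where s: "1 / 2 < Q (Suc (T + s))" using asym by blast
    define q where "q = Q (Suc (T + s))"
    have nn: "0 \<le> F s m" for m
      using mon(1)[of s] mon(2)[where s = s] zero[of s] 1 by (cases "m = 0"; cases "m = 1") auto
    have "(\<lambda>m. step q (F s) m - step (1 - q) (F s) m) = (\<lambda>m. (2 * q - 1) * F s m + 0 * F s m)"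
    proof
      fix m
      show "step q (F s) m - step (1 - q) (F s) m = (2 * q - 1) * F s m + 0 * F s m"
        using mon(1)[of s] mon(2)[where s = s] zero[of s] 1
        by (cases "m = 0"; cases "m = 1") (auto simp: step_def stay_0 stay_1 fall_1)
    qed
    then have "(\<lambda>j. (2 * q - 1) * tail M Q (Suc (T + s)) (F s) j) sums 0"
      using tail_diff_sums[OF F[of s]] tail_linear[of M Q _ "2 * q - 1" "F s" 0 "F s", abs_def]
      by (simp add: q_def)
    moreover have "0 \<le> (2 * q - 1) * tail M Q (Suc (T + s)) (F s) j" for j
      using s tail_nonneg[OF nn] by (simp add: q_def)
    ultimately have "(2 * q - 1) * tail M Q (Suc (T + s)) (F s) 0 = 0"
      by (rule nonneg_sums_0)
    moreover have "0 < mass M (F s)"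
      unfolding mass_def using mon(1)[of s] 1 M nn by (intro sum_pos2[of _ 1]) auto
    ultimately show False using s by (simp add: q_def tail_def)
  next
    case 2
    obtain s where s: "1 / 2 < Q (Suc (T + s))" using asym by blast
    define q where "q = Q (Suc (T + s))"
    define p where "p = 1 - q"
    \<comment> \<open>The vector \<open>e\<close> is a common eigenvector:
      \<open>step y e = y\<^sup>2 * e\<close> for every \<open>y\<close>. Subtracting the two
      recursions for the coefficient at 1 in a slot with \<open>p < q\<close> forces the value
      \<open>-2\<close>.\<close>
    define e where "e = (\<lambda>m :: nat. if m = 1 then - 2 else if m = 2 then 1 else 0 :: real)"
    have q: "0 < p" "p < q" "p + q = 1"
      using s unpopular_pos[of "Suc (T + s)"] by (auto simp: p_def q_def)
    have F2: "F s 2 = 1" "F (Suc s) 2 = 1" using mon 2 by auto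
    have "F (Suc s) 1 * q\<^sup>2 = q * F s 1 + 2 * q * p"
      using pop[of s 1] F2 2 by (simp add: step_def stay_1 stay_2 fall_2 numeral_2_eq_2[symmetric] q_def p_def)
    then have "q * (F (Suc s) 1 * q) = q * (F s 1 + 2 * p)"
      by (simp add: power2_eq_square algebra_simps)
    then have 1: "F (Suc s) 1 * q = F s 1 + 2 * p" using q by simp
    have "F (Suc s) 1 * p\<^sup>2 = p * F s 1 + 2 * p * q"
      using unpop[of s 1] F2 2 by (simp add: step_def stay_1 stay_2 fall_2 numeral_2_eq_2[symmetric] q_def p_def)
    then have "p * (F (Suc s) 1 * p) = p * (F s 1 + 2 * q)"
      by (simp add: power2_eq_square algebra_simps)
    then have 2: "F (Suc s) 1 * p = F s 1 + 2 * q" using q by simp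
    from 1 2 have "(F (Suc s) 1 + 2) * (q - p) = 0" by (simp add: algebra_simps)
    then have "F (Suc s) 1 = - 2" using q by simp
    then have "F (Suc s) m = e m" for m
      using mon(1)[of "Suc s"] mon(2)[where s = "Suc s" and m = m] zero[of "Suc s"] \<open>k = 2\<close>
      by (cases "m = 0"; cases "m = 1"; cases "m = 2") (auto simp: e_def)
    then have e: "F (Suc s) = e" by (rule ext)
    have mix_e: "mix x e m = (x * x\<^sup>2 + (1 - x) * (1 - x)\<^sup>2) * e m" for x m
    proof -
      have "step y e m = y\<^sup>2 * e m" for y
        unfolding step_def
        by (cases "m = 0"; cases "m = 1"; cases "m = 2")
          (auto simp: e_def stay_0 stay_1 stay_2 fall_1 fall_2[unfolded numeral_2_eq_2]
            power2_eq_square algebra_simps)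
      then show ?thesis by (simp add: mix_def algebra_simps)
    qed
    have ev: "\<exists>c>0. evolve Q t e j = (\<lambda>m. c * e m)" for t j
    proof (induction j)
      case 0
      then show ?case by (intro exI[of _ 1]) simp
    next
      case (Suc j)
      then obtain c where c: "c > 0" "evolve Q t e j = (\<lambda>m. c * e m)" by blast
      let ?x = "Q (Suc (t + j))"
      have "0 < ?x * ?x\<^sup>2 + (1 - ?x) * (1 - ?x)\<^sup>2"
        using Q_bounds[of "Suc (t + j)"] by (intro add_pos_nonneg mult_pos_pos mult_nonneg_nonneg) auto
      moreover have "evolve Q t e (Suc j) = (\<lambda>m. (c * (?x * ?x\<^sup>2 + (1 - ?x) * (1 - ?x)\<^sup>2)) * e m)"
        using c(2) mix_linear[of ?x c e 0 e] by (simp add: mix_e mult.assoc)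
      ultimately show ?case using c(1) by (metis mult_pos_pos)
    qed
    have "mass M e = - 1"
    proof -
      have "mass M e = sum e {1, 2}"
        unfolding mass_def using M by (intro sum.mono_neutral_right) (auto simp: e_def)
      then show ?thesis by (simp add: e_def)
    qed
    \<comment> \<open>All terms have the same strict sign, so no nonzero multiple of
      \<open>e\<close> can have future cost 0.\<close>
    then have neg: "tail M Q t e j < 0" for t j
    proof -
      obtain c where "c > 0" "evolve Q t e j = (\<lambda>m. c * e m + 0 * e m)" using ev[of t j] by auto
      then show ?thesis using \<open>mass M e = - 1\<close> unfolding tail_def by (simp only: mass_linear)
    qed
    have "(\<lambda>m. step q (F s) m - step (1 - q) (F s) m) = (\<lambda>m. (q\<^sup>2 - p\<^sup>2) * e m + 0 * e m)"
      using pop[of s] unpop[of s] \<open>k = 2\<close> by (simp add: e stay_2 q_def p_def fun_eq_iff algebra_simps)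
    then have "(\<lambda>j. (q\<^sup>2 - p\<^sup>2) * tail M Q (Suc (T + s)) e j) sums 0"
      using tail_diff_sums[OF F[of s]] tail_linear[of M Q _ "q\<^sup>2 - p\<^sup>2" e 0 e, abs_def]
      by (simp add: q_def)
    from sums_minus[OF this] have "(\<lambda>j. (q\<^sup>2 - p\<^sup>2) * - tail M Q (Suc (T + s)) e j) sums 0" by simp
    moreover have pq: "0 < q\<^sup>2 - p\<^sup>2" using q by (simp add: power_strict_mono)
    then have "0 \<le> (q\<^sup>2 - p\<^sup>2) * - tail M Q (Suc (T + s)) e j" for j
      using neg[of "Suc (T + s)" j] by (intro mult_nonneg_nonneg) auto
    ultimately have "(q\<^sup>2 - p\<^sup>2) * - tail M Q (Suc (T + s)) e 0 = 0"
      by (rule nonneg_sums_0)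
    then show False using pq neg[of "Suc (T + s)" 0] by simp
  next
    case 3
    let ?P = "\<lambda>s. 1 - Q (Suc (T + s))"
    \<comment> \<open>By \<open>Q_lt\<close>, \<open>1 < (M + 1) * p\<close>, which keeps the
      unpopular probability away from 0 uniformly in time.\<close>
    let ?e = "1 / (real M + 1)"
    have P: "?e \<le> ?P s" "0 < ?P s" "?P s \<le> 1 / 2" for s
    proof -
      have "1 < ?P s * (real M + 1)" using Q_lt[of "Suc (T + s)"] by (simp add: algebra_simps)
      then show "?e \<le> ?P s" by (simp add: pos_divide_le_eq)
    qed (use unpopular_pos[of "Suc (T + s)"] Q_bounds in auto)
    \<comment> \<open>Downward induction from the leading coefficient: coefficient \<open>n\<close>
      is multiplied by a factor of at most 1 and receives a positive share of coefficient
      \<open>n + 1\<close>. The bound \<open>2 \<le> n\<close> matters because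
      \<open>fall x (Suc n)\<close> and \<open>stay_mono\<close> need it.\<close>
    have positive: "\<exists>d>0. \<exists>s0. \<forall>s\<ge>s0. d \<le> F s m" if m: "2 \<le> m" "m \<le> k" for m
      using m(2)
    proof (induction rule: inc_induct)
      case base
      then show ?case using mon(1) by (intro exI[of _ 1]) auto
    next
      case (step n)
      then obtain d s0 where d: "0 < d" "\<And>s. s0 \<le> s \<Longrightarrow> d \<le> F s (Suc n)" by blast
      have n: "2 \<le> n" using step m by simp
      \<comment> \<open>This bounds the inflow from below:
        \<open>fall p (Suc n) \<ge> p ^ n * (1 - p)\<close> with \<open>p \<ge> ?e\<close> and
        \<open>1 - p \<ge> 1/2\<close>, and dividing by \<open>stay p k \<le> 1\<close> only
        helps.\<close>
      let ?d = "?e ^ n * (1 / 2) * d"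
      have d': "0 < ?d" using d by simp
      have "stay (?P s) n / stay (?P s) k * F s n + ?d \<le> F (Suc s) n" if "s0 \<le> s" for s
      proof -
        have st: "0 < stay (?P s) k" "stay (?P s) k \<le> 1"
          using P[of s] k by (auto intro!: stay_pos stay_le_1)
        have "?e ^ n * (1 / 2) \<le> ?P s ^ n * (1 - ?P s)"
          using P[of s] M by (intro mult_mono power_mono) auto
        also have "\<dots> \<le> fall (?P s) (Suc n)"
          using P[of s] n mult_right_mono[of 1 "real (Suc n)" "?P s ^ n * (1 - ?P s)"]
          by (simp add: fall_def)
        finally have "?d \<le> fall (?P s) (Suc n) * d" using d(1) by (intro mult_right_mono) auto
        also have "\<dots> \<le> fall (?P s) (Suc n) * F s (Suc n)"
          using d(2)[OF that] P[of s] by (intro mult_left_mono fall_nonneg) auto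
        finally have "?d \<le> fall (?P s) (Suc n) * F s (Suc n)" .
        moreover have "?d * stay (?P s) k \<le> ?d"
          using mult_left_mono[of "stay (?P s) k" 1 ?d] st d' by simp
        ultimately have le: "?d * stay (?P s) k \<le> fall (?P s) (Suc n) * F s (Suc n)" by linarith
        have "(stay (?P s) n / stay (?P s) k * F s n + ?d) * stay (?P s) k
            = stay (?P s) n * F s n + ?d * stay (?P s) k"
          unfolding distrib_right using st by simp
        also have "\<dots> \<le> F (Suc s) n * stay (?P s) k"
          unfolding unpop step_def using le by simp
        finally have "(stay (?P s) n / stay (?P s) k * F s n + ?d) * stay (?P s) k
            \<le> F (Suc s) n * stay (?P s) k" .
        then show ?thesis using st by (simp only: mult_le_cancel_right_pos)
      qed
      moreover have "0 \<le> stay (?P s) n / stay (?P s) k" "stay (?P s) n / stay (?P s) k \<le> 1" for s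
        using P[of s] step n stay_pos[of "?P s" k] stay_nonneg[of "?P s" n] stay_mono[of "?P s" n k] k
        by auto
      ultimately have "\<exists>s1. \<forall>s\<ge>s1. ?d \<le> F s n"
        by (rule eventually_bounded_below[OF d'])
      then show ?case using d' by blast
    qed
    obtain d2 s2 where d2: "0 < d2" "\<And>s. s2 \<le> s \<Longrightarrow> d2 \<le> F s 2"
      using positive[of 2] 3 by auto
    obtain d3 s3 where d3: "0 < d3" "\<And>s. s3 \<le> s \<Longrightarrow> d3 \<le> F s 3"
      using positive[of 3] 3 by auto
    obtain s where s: "max s2 s3 \<le> s" "1 / 2 < Q (Suc (T + s))" using asym by blast
    define q where "q = Q (Suc (T + s))"
    define p where "p = 1 - q"
    have q: "0 < p" "p < q" "p + q = 1"
      using s unpopular_pos[of "Suc (T + s)"] by (auto simp: p_def q_def)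
    have F23: "0 < F s 2" "0 < F s 3"
      using d2(1) d2(2)[of s] d3(1) d3(2)[of s] s(1) by auto
    have a: "F (Suc s) 2 * stay q k = q\<^sup>2 * (F s 2 + 3 * p * F s 3)"
      using pop[of s 2] by (simp add: step_def stay_2 fall_3 numeral_3_eq_3[symmetric] q_def p_def algebra_simps)
    have b: "F (Suc s) 2 * stay p k = p\<^sup>2 * (F s 2 + 3 * q * F s 3)"
      using unpop[of s 2] by (simp add: step_def stay_2 fall_3 numeral_3_eq_3[symmetric] q_def p_def algebra_simps)
    have st: "0 < stay p k" using q k by (intro stay_pos) auto
    \<comment> \<open>Cross-multiplying \<open>a\<close> and \<open>b\<close> eliminates the new
      coefficient; \<open>stay_ratio\<close> costs a factor of at most \<open>q / p\<close>, and
      positivity of the coefficient at 2 makes the comparison strict.\<close>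
    have "q\<^sup>2 * (F s 2 + 3 * p * F s 3) * stay p k = p\<^sup>2 * (F s 2 + 3 * q * F s 3) * stay q k"
      using a b by (metis mult.assoc mult.commute)
    also have "\<dots> = p * (F s 2 + 3 * q * F s 3) * (p * stay q k)"
      by (simp add: power2_eq_square)
    also have "\<dots> \<le> p * (F s 2 + 3 * q * F s 3) * (q * stay p k)"
      using stay_ratio[of p q k] q F23 3 by (intro mult_left_mono) auto
    also have "\<dots> = q * stay p k * (p * F s 2 + 3 * p * q * F s 3)" by (simp add: algebra_simps)
    also have "\<dots> < q * stay p k * (q * F s 2 + 3 * p * q * F s 3)"
      using q st F23 by (intro mult_strict_left_mono) auto
    also have "\<dots> = q\<^sup>2 * (F s 2 + 3 * p * F s 3) * stay p k"
      by (simp add: power2_eq_square algebra_simps)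
    finally show False by simp
  qed
qed

end

section \<open>Idling against an eventually fair protocol\<close>

text \<open>The expected remaining latency, current slot included, with \<open>m\<close> others
  pending when both channels have probability \<open>1/2\<close>. The recursion is
  \<open>fair_latency_fixpoint\<close> solved for the unknown. State 1 never falls to 0 while the
  tagged player transmits, hence its own base value; state 0 arises only by idling.\<close>

fun fair_latency :: "nat \<Rightarrow> real" where
  "fair_latency 0 = 1"
| "fair_latency (Suc 0) = 2"
| "fair_latency (Suc (Suc m)) = (2 ^ (m + 2) + real (m + 2) * fair_latency (Suc m)) / real (m + 3)"

lemma fair_latency_Suc:
  "2 \<le> m \<Longrightarrow> real (m + 1) * fair_latency m = 2 ^ m + real m * fair_latency (m - 1)"
proof -
  assume "2 \<le> m"
  then obtain j where "m = Suc (Suc j)" by (metis add_2_eq_Suc le_Suc_ex)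
  then show ?thesis by (simp add: field_simps)
qed

lemma fair_latency_values: "fair_latency 2 = 8 / 3" "fair_latency 3 = 4" "fair_latency 4 = 32 / 5"
  by (simp_all add: eval_nat_numeral)

lemma fair_latency_pos: "0 < fair_latency m"
proof (induction m rule: fair_latency.induct)
  case (3 m)
  then have "0 < 2 ^ (m + 2) + real (m + 2) * fair_latency (Suc m)"
    by (intro add_pos_nonneg mult_nonneg_nonneg) auto
  then show ?case by simp
qed simp_all

lemma fall_half: "2 \<le> m \<Longrightarrow> fall (1/2) m = real m / 2 ^ m"
  by (cases m) (auto simp: fall_def power_one_over field_simps)

lemma stay_half: "2 \<le> m \<Longrightarrow> stay (1/2) m = 1 - real (m + 1) / 2 ^ m"
  by (simp add: stay_def fall_half power_one_over field_simps)

lemma fair_latency_fixpoint: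
  "fair_latency m = 1 + stay (1/2) m * fair_latency m + fall (1/2) m * fair_latency (m - 1)"
proof -
  consider "m = 0" | "m = 1" | "2 \<le> m" by linarith
  then show ?thesis
  proof cases
    case 3
    then show ?thesis
      using fair_latency_Suc[OF 3] by (simp add: stay_half fall_half field_simps)
  qed (simp_all add: stay_0 fall_0 stay_1 fall_1)
qed

text \<open>At \<open>m - 1\<close> this decides the sign of the gain from idling with
  \<open>m\<close> others; for \<open>m - 1 = 2\<close> it would be an equality, matching the
  neutral case of three others.\<close>

lemma fair_latency_less: "3 \<le> m \<Longrightarrow> real (m + 1) * fair_latency m < real m * 2 ^ m"
proof (induction rule: dec_induct)
  case base
  then show ?case by (simp add: fair_latency_values)
next
  case (step m)
  have "real (Suc m + 1) * fair_latency (Suc m) = 2 ^ Suc m + real (m + 1) * fair_latency m"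
    using fair_latency_Suc[of "Suc m"] step by simp
  also have "\<dots> < 2 ^ Suc m + real m * 2 ^ m" using step by simp
  also have "\<dots> \<le> real (Suc m) * 2 ^ Suc m" by (simp add: algebra_simps)
  finally show ?case .
qed

lemma idle_fall_half: "2 \<le> m \<Longrightarrow> idle_fall (1/2) m = 2 * real m / 2 ^ m"
  by (cases m) (auto simp: idle_fall_def power_one_over field_simps)

text \<open>The expected latency remaining after an idle slot, that slot not counted. Its
  counterpart for a transmission is \<open>fair_latency m - 1\<close>.\<close>

definition idle_value :: "nat \<Rightarrow> real" where
  "idle_value m = (if m \<le> 1 then 1 else if m = 2 then 1/2 + fair_latency 2 / 2
    else (1 - idle_fall (1/2) m) * fair_latency m + idle_fall (1/2) m * fair_latency (m - 1))"

text \<open>Replacing \<open>2 ^ m\<close> by the recursion for \<open>fair_latency\<close> leaves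
  only two consecutive latencies.\<close>

lemma idle_value_ge_3:
  assumes "3 \<le> m"
  shows "2 ^ m * (idle_value m - (fair_latency m - 1))
    = real m * fair_latency (m - 1) - real (m - 1) * fair_latency m"
proof -
  let ?x = "fair_latency m" and ?y = "fair_latency (m - 1)"
  have w: "2 ^ m * idle_fall (1/2) m = 2 * real m" using assms by (simp add: idle_fall_half)
  have "2 ^ m * idle_value m = 2 ^ m * ?x - (2 ^ m * idle_fall (1/2) m) * (?x - ?y)"
    using assms by (simp add: idle_value_def algebra_simps)
  then have "2 ^ m * idle_value m = 2 ^ m * ?x - 2 * real m * (?x - ?y)" unfolding w .
  moreover have "2 ^ m = real (m + 1) * ?x - real m * ?y"
    using fair_latency_Suc[of m] assms by simp
  moreover have "2 ^ m * (idle_value m - (?x - 1)) = 2 ^ m * idle_value m - 2 ^ m * ?x + 2 ^ m"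
    by (simp add: algebra_simps)
  ultimately have "2 ^ m * (idle_value m - (?x - 1))
      = real (m + 1) * ?x - real m * ?y - 2 * real m * (?x - ?y)" by linarith
  then show ?thesis using assms by (simp add: algebra_simps of_nat_diff)
qed

lemma idle_value_less:
  assumes "5 \<le> m"
  shows "idle_value m < fair_latency m - 1"
proof -
  let ?x = "fair_latency m" and ?y = "fair_latency (m - 1)"
  have eq: "real (m + 1) * ?x = 2 ^ m + real m * ?y" using fair_latency_Suc[of m] assms by simp
  have "real (m - 1 + 1) * ?y < real (m - 1) * 2 ^ (m - 1)" using fair_latency_less[of "m - 1"] assms by simp
  then have y: "2 * (real m * ?y) < (real m - 1) * 2 ^ m"
    using assms by (cases m) (auto simp: algebra_simps)
  have "real (m + 1) * (real m * ?y - real (m - 1) * ?x)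
      = real (m + 1) * real m * ?y - (real m - 1) * (real (m + 1) * ?x)"
    using assms by (simp add: of_nat_diff algebra_simps)
  also have "\<dots> = 2 * (real m * ?y) - (real m - 1) * 2 ^ m"
    unfolding eq by (simp add: algebra_simps)
  finally have "real (m + 1) * (real m * ?y - real (m - 1) * ?x) < 0" using y by linarith
  then have "real m * ?y - real (m - 1) * ?x < 0"
    by (simp add: mult_less_0_iff)
  then have "2 ^ m * (idle_value m - (?x - 1)) < 0"
    using idle_value_ge_3[of m] assms by simp
  then have "idle_value m - (?x - 1) < 0" by (simp add: mult_less_0_iff)
  then show ?thesis by simp
qed

text \<open>The weight \<open>4/21 < 1/5\<close> balances \<open>1/6\<close> exactly at the bound \<open>8/7\<close> on the ratio of the beliefs in 2 and 4.\<close>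

definition idle_bound :: "nat \<Rightarrow> real" where
  "idle_bound m = (if m = 2 then 1 / 6 else if m = 4 then - (4 / 21) else 0)"

lemma idle_value_small:
  "idle_value 1 = fair_latency 1 - 1" "idle_value 2 = fair_latency 2 - 1 + 1 / 6"
  "idle_value 3 = fair_latency 3 - 1" "idle_value 4 = fair_latency 4 - 1 - 1 / 5"
proof -
  show "idle_value 3 = fair_latency 3 - 1" "idle_value 4 = fair_latency 4 - 1 - 1 / 5"
    using idle_value_ge_3[of 3] idle_value_ge_3[of 4] by (simp_all add: fair_latency_values)
qed (simp_all add: idle_value_def fair_latency_values)

lemma idle_value_le: "1 \<le> m \<Longrightarrow> idle_value m - (fair_latency m - 1) \<le> idle_bound m"
  and idle_value_lt: "4 \<le> m \<Longrightarrow> idle_value m - (fair_latency m - 1) < idle_bound m"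
proof -
  show lt: "4 \<le> m \<Longrightarrow> idle_value m - (fair_latency m - 1) < idle_bound m"
    using idle_value_less[of m] idle_value_small(4) by (cases "m = 4") (auto simp: idle_bound_def)
  assume "1 \<le> m"
  then consider "m = 1" | "m = 2" | "m = 3" | "4 \<le> m" by linarith
  then show "idle_value m - (fair_latency m - 1) \<le> idle_bound m"
  proof cases
    case 4 then show ?thesis using lt by simp
  qed (use idle_value_small in \<open>simp_all add: idle_bound_def\<close>)
qed

lemma mix_half: "mix (1/2) f = step (1/2) f"
  by (simp add: mix_def fun_eq_iff)

section \<open>Future cost of a belief once the protocol is fair\<close>

definition potential :: "nat \<Rightarrow> (nat \<Rightarrow> real) \<Rightarrow> real" where
  "potential M f = (\<Sum>m\<le>M. fair_latency m * f m)"

lemma potential_step_eq: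
  assumes "\<And>m. M < m \<Longrightarrow> f m = 0"
  shows "potential M (step (1/2) f) = (\<Sum>m\<le>M. f m * (fair_latency m - 1))"
proof -
  have "stay (1/2) m * fair_latency m + fall (1/2) m * fair_latency (m - 1) = fair_latency m - 1" for m
    using fair_latency_fixpoint[of m] by linarith
  moreover have "potential M (step (1/2) f)
      = (\<Sum>m\<le>M. f m * (stay (1/2) m * fair_latency m + fall (1/2) m * fair_latency (m - 1)))"
    unfolding potential_def by (rule sum_step) (rule assms)
  ultimately show ?thesis by simp
qed

lemma potential_step:
  assumes "\<And>m. M < m \<Longrightarrow> f m = 0"
  shows "potential M f = mass M f + potential M (step (1/2) f)"
proof -
  have "potential M (step (1/2) f) = (\<Sum>m\<le>M. f m * (fair_latency m - 1))"
    by (rule potential_step_eq) (rule assms)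
  then show ?thesis
    by (simp add: potential_def mass_def sum_subtractf algebra_simps)
qed

lemma sum_of_bool_eq: "a \<le> (M::nat) \<Longrightarrow> (\<Sum>m\<le>M. c * of_bool (m = a) * L m) = c * (L a :: real)"
  by (simp add: of_bool_def if_distrib[of "\<lambda>x. x * _"] if_distrib[of "\<lambda>x. _ * x"] cong: if_cong)

lemma potential_idle:
  "potential M (idle M (1/2) f) = (\<Sum>m\<le>M. f m * idle_value m)"
proof -
  have "(\<Sum>m'\<le>M. idle_kernel (1/2) m m' * fair_latency m') = idle_value m" if m: "m \<le> M" for m
  proof -
    consider "m \<le> 1" | "m = 2" | "3 \<le> m" by linarith
    then show ?thesis
    proof cases
      case 1
      then have "(\<Sum>m'\<le>M. idle_kernel (1/2) m m' * fair_latency m')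
          = (\<Sum>m'\<le>M. 1 * of_bool (m' = 0) * fair_latency m')"
        by (simp add: idle_kernel_def)
      then show ?thesis using 1 by (simp only: sum_of_bool_eq) (simp add: idle_value_def)
    next
      case 2
      then have "(\<Sum>m'\<le>M. idle_kernel (1/2) m m' * fair_latency m')
          = (\<Sum>m'\<le>M. (1/2) * of_bool (m' = 0) * fair_latency m')
            + (\<Sum>m'\<le>M. (1/2) * of_bool (m' = 2) * fair_latency m')"
        by (simp add: idle_kernel_def sum.distrib algebra_simps)
      then show ?thesis using 2 m by (simp only: sum_of_bool_eq) (simp add: idle_value_def)
    next
      case 3
      have "(m = Suc m') = (m' = m - 1)" for m' using 3 by auto
      then have "idle_kernel (1/2) m m' * fair_latency m'
          = (1 - idle_fall (1/2) m) * of_bool (m' = m) * fair_latency m'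
            + idle_fall (1/2) m * of_bool (m' = m - 1) * fair_latency m'" for m'
        using 3 by (simp add: idle_kernel_def algebra_simps)
      then have "(\<Sum>m'\<le>M. idle_kernel (1/2) m m' * fair_latency m')
          = (\<Sum>m'\<le>M. (1 - idle_fall (1/2) m) * of_bool (m' = m) * fair_latency m')
            + (\<Sum>m'\<le>M. idle_fall (1/2) m * of_bool (m' = m - 1) * fair_latency m')"
        by (simp only: sum.distrib)
      then show ?thesis using 3 m by (simp add: sum_of_bool_eq idle_value_def)
    qed
  qed
  then have "(\<Sum>m\<le>M. f m * idle_value m)
      = (\<Sum>m\<le>M. f m * (\<Sum>m'\<le>M. idle_kernel (1/2) m m' * fair_latency m'))" by simp
  also have "\<dots> = (\<Sum>m\<le>M. \<Sum>m'\<le>M. fair_latency m' * (f m * idle_kernel (1/2) m m'))"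
    by (simp add: sum_distrib_left mult_ac)
  also have "\<dots> = potential M (idle M (1/2) f)"
    unfolding potential_def idle_def sum_distrib_left by (rule sum.swap)
  finally show ?thesis ..
qed

lemma idle_half_nonneg:
  assumes "\<And>m. 0 \<le> f m"
  shows "0 \<le> idle M (1/2) f m'"
proof -
  have "0 \<le> idle_kernel (1/2) m m'" for m
  proof (cases "3 \<le> m")
    case True
    then have "2 * real m \<le> 2 ^ m"
    proof (induction rule: dec_induct)
      case (step n)
      then show ?case by simp
    qed simp
    then show ?thesis using True by (simp add: idle_kernel_def idle_fall_half)
  qed (auto simp: idle_kernel_def)
  then show ?thesis unfolding idle_def using assms by (intro sum_nonneg mult_nonneg_nonneg)
qed

context contention begin

text \<open>In each fair slot the potential drops by exactly the mass, so the sum telescopes. The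
  remainder is at most a constant times the current mass, which tends to 0 because the masses are
  summable.\<close>

lemma tail_sums_potential:
  assumes sym: "\<And>s. t < s \<Longrightarrow> Q s = 1 / 2"
    and f: "\<And>m. 0 \<le> f m" "\<And>m. M < m \<Longrightarrow> f m = 0"
  shows "tail M Q t f sums potential M f"
proof -
  have supp: "M < m \<Longrightarrow> evolve Q t f j m = 0" for j m
  proof (induction j arbitrary: m)
    case (Suc j)
    then show ?case by (simp add: mix_def step_def)
  qed (simp add: f)
  have nn: "0 \<le> evolve Q t f j m" for j m by (rule evolve_nonneg[OF f(1)])
  have partial: "(\<Sum>j<N. tail M Q t f j) = potential M f - potential M (evolve Q t f N)" for N
  proof (induction N)
    case (Suc N)
    have "potential M (evolve Q t f N) = tail M Q t f N + potential M (evolve Q t f (Suc N))"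
      using potential_step[of M "evolve Q t f N"] supp
      by (simp add: sym mix_half tail_def)
    then show ?case using Suc by simp
  qed simp
  have pot_nn: "0 \<le> potential M (evolve Q t f N)" for N
    unfolding potential_def using nn fair_latency_pos by (intro sum_nonneg mult_nonneg_nonneg) (auto intro: less_imp_le)
  have "summable (tail M Q t f)"
    by (rule summableI_nonneg_bounded[of _ "potential M f"])
      (use partial pot_nn tail_nonneg[OF f(1)] in auto)
  then have "tail M Q t f \<longlonglongrightarrow> 0" by (rule summable_LIMSEQ_zero)
  then have "(\<lambda>N. (\<Sum>m\<le>M. fair_latency m) * tail M Q t f N) \<longlonglongrightarrow> 0"
    using tendsto_mult_right_zero by blast
  moreover have "potential M (evolve Q t f N) \<le> (\<Sum>m\<le>M. fair_latency m) * tail M Q t f N" for N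
    unfolding potential_def tail_def mass_def sum_distrib_left
  proof (rule sum_mono)
    fix m assume "m \<in> {..M}"
    then have "fair_latency m \<le> (\<Sum>m\<le>M. fair_latency m)"
      using fair_latency_pos by (intro member_le_sum) (auto intro: less_imp_le)
    then show "fair_latency m * evolve Q t f N m \<le> (\<Sum>m\<le>M. fair_latency m) * evolve Q t f N m"
      using nn by (intro mult_right_mono)
  qed
  ultimately have "(\<lambda>N. potential M (evolve Q t f N)) \<longlonglongrightarrow> 0"
    using pot_nn by (intro tendsto_sandwich[of "\<lambda>_. 0" "\<lambda>N. potential M (evolve Q t f N)"]) auto
  from tendsto_diff[OF tendsto_const[of "potential M f"] this] show ?thesis
    unfolding sums_def partial by simp
qed

text \<open>The constants are the fixed points of the ratio recursions at \<open>p = 1/2\<close>,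
  with the inflow into state 4 ignored and the second taken at ratio \<open>4/3\<close> of states 3
  and 4. For smaller \<open>p\<close> the slack carries the factor
  \<open>1 - 2 * p \<ge> 0\<close>.\<close>

lemma unpopular_ratios:
  defines "G \<equiv> state M Q (\<lambda>_. Unpopular)"
  shows "G t 3 \<le> 4 / 3 * G t 4 \<and> G t 2 \<le> 6 / 7 * G t 3"
proof (induction t)
  case 0
  then show ?case using M by (simp add: G_def)
next
  case (Suc t)
  define q where "q = Q (Suc t)"
  define p where "p = 1 - q"
  have p: "0 \<le> p" "p \<le> 1 / 2" and q: "q = 1 - p" using Q_bounds[of "Suc t"] by (auto simp: p_def q_def)
  have G: "0 \<le> G t m" for m unfolding G_def by (rule state_nonneg) simp
  have GS: "G (Suc t) m = stay p m * G t m + fall p (Suc m) * G t (Suc m)" for m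
    by (simp add: G_def step_def p_def q_def)
  have s3: "stay p 3 = p ^ 3 + 3 * p * (1 - p)\<^sup>2" and f4: "fall p 4 = 4 * p ^ 3 * (1 - p)"
    and s4: "stay p 4 = stay p 3 + 3 / 4 * fall p 4 + p * (1 - p) * ((1 - 2 * p) * (1 + 3 * p))"
    by (simp_all add: stay_def fall_def eval_nat_numeral algebra_simps)
  have "0 \<le> p * (1 - p) * ((1 - 2 * p) * (1 + 3 * p))" using p by auto
  then have s43: "stay p 3 + 3 / 4 * fall p 4 \<le> stay p 4" unfolding s4 by linarith
  have nn: "0 \<le> stay p m" "0 \<le> fall p m" for m using p by (auto intro: stay_nonneg fall_nonneg)
  have "G (Suc t) 3 = stay p 3 * G t 3 + fall p 4 * G t 4" using GS[of 3] by (simp add: eval_nat_numeral)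
  also have "\<dots> \<le> stay p 3 * (4 / 3 * G t 4) + fall p 4 * G t 4"
    using Suc nn by (intro add_right_mono mult_left_mono) auto
  also have "\<dots> = 4 / 3 * ((stay p 3 + 3 / 4 * fall p 4) * G t 4)" by (simp add: algebra_simps)
  also have "\<dots> \<le> 4 / 3 * (stay p 4 * G t 4)"
    using s43 G by (intro mult_left_mono mult_right_mono) auto
  also have "\<dots> \<le> 4 / 3 * G (Suc t) 4"
    using GS[of 4] nn G by simp
  finally have first: "G (Suc t) 3 \<le> 4 / 3 * G (Suc t) 4" .
  have "6 / 7 * (stay p 3 + 3 / 4 * fall p 4) - (6 / 7 * p\<^sup>2 + 3 * p\<^sup>2 * (1 - p))
      = 3 / 7 * p * (3 * (1 - 2 * p) * (1 - p) * (2 - p))"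
    unfolding s3 f4 by (simp add: eval_nat_numeral field_simps)
  moreover have "0 \<le> 3 / 7 * p * (3 * (1 - 2 * p) * (1 - p) * (2 - p))" using p by simp
  ultimately have key: "6 / 7 * p\<^sup>2 + 3 * p\<^sup>2 * (1 - p) \<le> 6 / 7 * (stay p 3 + 3 / 4 * fall p 4)"
    by linarith
  have "G (Suc t) 2 = p\<^sup>2 * G t 2 + 3 * p\<^sup>2 * (1 - p) * G t 3"
    using GS[of 2] by (simp add: stay_2 fall_3[unfolded numeral_3_eq_3] numeral_2_eq_2[symmetric] numeral_3_eq_3[symmetric] fall_3)
  also have "\<dots> \<le> p\<^sup>2 * (6 / 7 * G t 3) + 3 * p\<^sup>2 * (1 - p) * G t 3"
    using Suc by (intro add_right_mono mult_left_mono) auto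
  also have "\<dots> = (6 / 7 * p\<^sup>2 + 3 * p\<^sup>2 * (1 - p)) * G t 3" by (simp add: algebra_simps)
  also have "\<dots> \<le> 6 / 7 * (stay p 3 + 3 / 4 * fall p 4) * G t 3"
    using key G by (intro mult_right_mono) auto
  also have "\<dots> = 6 / 7 * (stay p 3 * G t 3 + fall p 4 * (3 / 4 * G t 3))" by (simp add: algebra_simps)
  also have "\<dots> \<le> 6 / 7 * (stay p 3 * G t 3 + fall p 4 * G t 4)"
    using Suc nn by (intro mult_left_mono add_left_mono) auto
  also have "\<dots> = 6 / 7 * G (Suc t) 3" using GS[of 3] by (simp add: eval_nat_numeral)
  finally show ?case using first by simp
qed

theorem contradiction: False
proof -
  obtain T where T: "\<And>t. T \<le> t \<Longrightarrow> Q t = 1 / 2" using eventually_symmetric by blast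
  let ?c = "\<lambda>_. Unpopular"
  let ?G = "state M Q ?c T"
  have c: "pure ?c" by (simp add: pure_def)
  have G: "belief M ?G" "\<And>m. 0 \<le> ?G m" "0 < ?G M"
    using state_top_pos[OF c Q_lt] by (auto intro: state_belief state_nonneg)
  have supp: "M < m \<Longrightarrow> ?G m = 0" for m using G(1) by (simp add: belief_def)
  have half: "Q (Suc T) = 1 / 2" using T by simp
  let ?S = "\<Sum>s<Suc T. mass M (state M Q ?c s)"
  \<comment> \<open>The profitable deviation: unpopular channel up to \<open>T\<close>, one idle
    slot, then the protocol.\<close>
  define d where "d = (\<lambda>s. if s \<le> T then Unpopular else if s = Suc T then Idle else Mixed)"
  have before: "state M Q d s = state M Q ?c s" if "s \<le> T" for s
    using that by (intro state_cong) (simp add: d_def)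
  have after: "state M Q d (s + Suc T) = evolve Q (Suc T) (idle M (1/2) ?G) s" for s
  proof -
    have "state M Q d (Suc T + s) = evolve Q (Suc T) (state M Q d (Suc T)) s"
      by (rule state_add) (simp add: d_def)
    moreover have "d (Suc T) = Idle" by (simp add: d_def)
    ultimately show ?thesis by (simp add: before half add.commute)
  qed
  have idle_supp: "M < m \<Longrightarrow> idle M (1/2) ?G m = 0" for m
    unfolding idle_def by (intro sum.neutral) (auto simp: idle_kernel_def)
  have sums_d: "(\<lambda>s. mass M (state M Q d s)) sums (potential M (idle M (1/2) ?G) + ?S)"
  proof -
    have "(\<lambda>s. mass M (state M Q d (s + Suc T))) sums potential M (idle M (1/2) ?G)"
      using tail_sums_potential[of "Suc T" "idle M (1/2) ?G", OF T idle_half_nonneg[OF G(2)] idle_supp]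
      unfolding after tail_def[abs_def] by simp
    then have "(\<lambda>s. mass M (state M Q d s)) sums
        (potential M (idle M (1/2) ?G) + (\<Sum>s<Suc T. mass M (state M Q d s)))"
      by (subst (asm) sums_iff_shift)
    then show ?thesis using before by (simp add: less_Suc_eq_le)
  qed
  have "0 \<le> mass M (state M Q d s)" for s
  proof (cases "s \<le> T")
    case True
    then show ?thesis using before by (simp add: mass_nonneg)
  next
    case False
    then obtain j where "s = j + Suc T" by (metis add.commute less_iff_Suc_add not_le add_Suc_right)
    then show ?thesis
      using after[of j] tail_nonneg[OF idle_half_nonneg[OF G(2)]] by (simp add: tail_def)
  qed
  then have "C \<le> potential M (idle M (1/2) ?G) + ?S" by (rule C_le[OF sums_d])
  moreover have "C = potential M (step (1/2) ?G) + ?S"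
  proof -
    have opt: "optimal ?c (Suc T)" by (rule optimal[OF c])
    have eq: "state M Q (switch_after ?c (Suc T)) (s + Suc T) = evolve Q (Suc T) (step (1/2) ?G) s" for s
      unfolding add.commute[of s] state_switch_after_add by (simp add: half)
    have "tail M Q (Suc T) (step (1/2) ?G) sums potential M (step (1/2) ?G)"
      using T G(2) step_belief[OF G(1), of "1/2"]
      by (intro tail_sums_potential step_nonneg) (auto simp: belief_def)
    then have "(\<lambda>s. mass M (state M Q (switch_after ?c (Suc T)) (s + Suc T))) sums potential M (step (1/2) ?G)"
      unfolding eq tail_def[abs_def] .
    then have "(\<lambda>s. mass M (state M Q (switch_after ?c (Suc T)) s)) sums
        (potential M (step (1/2) ?G) + (\<Sum>s<Suc T. mass M (state M Q (switch_after ?c (Suc T)) s)))"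
      by (subst (asm) sums_iff_shift)
    from sums_unique2[OF opt this] show ?thesis by (simp add: state_switch_after_le)
  qed
  ultimately have "0 \<le> potential M (idle M (1/2) ?G) - potential M (step (1/2) ?G)" by simp
  also have "\<dots> = (\<Sum>m\<le>M. ?G m * idle_value m) - (\<Sum>m\<le>M. ?G m * (fair_latency m - 1))"
    using potential_step_eq[of M ?G] supp by (simp add: potential_idle)
  also have "\<dots> = (\<Sum>m\<le>M. ?G m * (idle_value m - (fair_latency m - 1)))"
    by (simp only: sum_subtractf[symmetric] right_diff_distrib)
  \<comment> \<open>State 0 has weight 0, and strictness comes from state \<open>M \<ge> 4\<close>,
    whose weight is positive.\<close>
  also have "\<dots> < (\<Sum>m\<le>M. ?G m * idle_bound m)"
  proof (rule sum_strict_mono_ex1)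
    show "\<forall>m\<in>{..M}. ?G m * (idle_value m - (fair_latency m - 1)) \<le> ?G m * idle_bound m"
    proof
      fix m
      show "?G m * (idle_value m - (fair_latency m - 1)) \<le> ?G m * idle_bound m"
        using G idle_value_le[of m] by (cases "m = 0") (auto simp: belief_def intro!: mult_left_mono)
    qed
    show "\<exists>m\<in>{..M}. ?G m * (idle_value m - (fair_latency m - 1)) < ?G m * idle_bound m"
      using G(3) idle_value_lt[OF M] by (intro bexI[of _ M] mult_strict_left_mono) auto
  qed simp
  also have "\<dots> = (\<Sum>m\<in>{2, 4}. ?G m * idle_bound m)"
    using M by (intro sum.mono_neutral_right) (auto simp: idle_bound_def)
  also have "\<dots> = ?G 2 / 6 - 4 / 21 * ?G 4" by (simp add: idle_bound_def)
  \<comment> \<open>The two ratio bounds multiply to \<open>8/7\<close>, and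
    \<open>8/7 * 1/6 = 4/21\<close>.\<close>
  also have "\<dots> \<le> 0" using unpopular_ratios[of T] by simp
  finally show False by simp
qed

end

section \<open>From the protocol to the abstract game\<close>

lemma sum_two_kernel:
  fixes f :: "nat \<Rightarrow> real"
  assumes "\<And>m. M < m \<Longrightarrow> f m = 0"
  shows "(\<Sum>m\<le>M. f m * ((if m' = m then A m else 0) + (if m = Suc m' then B m else 0)))
    = A m' * f m' + B (Suc m') * f (Suc m')"
proof -
  have "(\<Sum>m\<le>M. f m * (if m' = m then A m else 0)) = A m' * f m'"
    using assms[of m'] by (cases "m' \<le> M") (auto simp: if_distrib[of "\<lambda>x. _ * x"] cong: if_cong)
  moreover have "(\<Sum>m\<le>M. f m * (if m = Suc m' then B m else 0)) = B (Suc m') * f (Suc m')"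
    using assms[of "Suc m'"] by (cases "Suc m' \<le> M") (auto simp: if_distrib[of "\<lambda>x. _ * x"] cong: if_cong)
  ultimately show ?thesis by (simp add: distrib_left sum.distrib)
qed

locale two_channels =
  fixes n :: nat and p :: "nat \<Rightarrow> nat pmf"
  assumes support: "memoryless_protocol 2 p" and busy: "\<forall>t\<ge>1. pmf (p t) 0 = 0"
begin

definition popular :: "nat \<Rightarrow> nat" where
  "popular t = (if pmf (p t) 2 \<le> pmf (p t) 1 then 1 else 2)"

definition unpopular :: "nat \<Rightarrow> nat" where
  "unpopular t = 3 - popular t"

text \<open>Slot 0 does not occur in the game and \<open>p 0\<close> may be idle; the value 1 there
  satisfies the bounds that \<open>contention\<close> imposes on every index.\<close>

definition popularity :: "nat \<Rightarrow> real" where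
  "popularity t = (if t = 0 then 1 else pmf (p t) (popular t))"

fun action :: "mode \<Rightarrow> nat \<Rightarrow> nat pmf" where
  "action Popular t = return_pmf (popular t)"
| "action Unpopular t = return_pmf (unpopular t)"
| "action Mixed t = p t"
| "action Idle t = return_pmf 0"

lemma channels: "popular t \<noteq> 0" "unpopular t \<noteq> 0" "popular t \<noteq> unpopular t"
  "popular t \<le> 2" "unpopular t \<le> 2" "{popular t, unpopular t} = {1, 2}"
  by (auto simp: popular_def unpopular_def)

lemma set_pmf_p: "1 \<le> t \<Longrightarrow> set_pmf (p t) \<subseteq> {popular t, unpopular t}"
proof
  fix a assume t: "1 \<le> t" and a: "a \<in> set_pmf (p t)"
  have "a \<in> {0..2}" using support a unfolding memoryless_protocol_def by blast
  then have "a \<le> 2" by simp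
  moreover have "a \<noteq> 0" using busy t a by (metis set_pmf_iff)
  ultimately have "a \<in> {1, 2}" by auto
  then show "a \<in> {popular t, unpopular t}" by (simp only: channels)
qed

lemma pmf_p: "1 \<le> t \<Longrightarrow> pmf (p t) (popular t) = popularity t"
  "1 \<le> t \<Longrightarrow> pmf (p t) (unpopular t) = 1 - popularity t"
proof -
  assume t: "1 \<le> t"
  show "pmf (p t) (popular t) = popularity t" using t by (simp add: popularity_def)
  moreover have "pmf (p t) (popular t) + pmf (p t) (unpopular t) = 1"
    using sum_pmf_eq_1[OF _ set_pmf_p[OF t]] channels(3)[of t] by simp
  ultimately show "pmf (p t) (unpopular t) = 1 - popularity t" by simp
qed

lemma popularity_bounds: "1 / 2 \<le> popularity t" "popularity t \<le> 1"
proof -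
  have "pmf (p t) (unpopular t) \<le> pmf (p t) (popular t)"
    by (auto simp: popular_def unpopular_def)
  then show "1 / 2 \<le> popularity t"
  proof (cases "t = 0")
    case False
    then have "pmf (p t) (popular t) = popularity t" "pmf (p t) (unpopular t) = 1 - popularity t"
      by (simp_all add: pmf_p)
    with \<open>pmf (p t) (unpopular t) \<le> pmf (p t) (popular t)\<close> show ?thesis by linarith
  qed (simp add: popularity_def)
  show "popularity t \<le> 1" by (auto simp: popularity_def pmf_le_1)
qed

lemma pmf_slot_popular: "1 \<le> t \<Longrightarrow> pmf (slot_pmf (p t) (popular t) m) (Some m') =
    (if m' = m then stay (popularity t) m else 0) + (if m = Suc m' then fall (popularity t) m else 0)"
  using pmf_slot_transmit[OF channels(1,2,3) set_pmf_p] pmf_p by simp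

lemma pmf_slot_unpopular: "1 \<le> t \<Longrightarrow> pmf (slot_pmf (p t) (unpopular t) m) (Some m') =
    (if m' = m then stay (1 - popularity t) m else 0) + (if m = Suc m' then fall (1 - popularity t) m else 0)"
  using pmf_slot_transmit[OF channels(2,1) channels(3)[symmetric], of "p t" t m m'] set_pmf_p[of t] pmf_p
  by (simp add: insert_commute)

text \<open>The bridge to the abstract evolution. Agreement is assumed from slot 1 on, since a
  deviation at slot 1 still uses \<open>p\<close> at the fictitious slot 0.\<close>

lemma pmf_pending_state:
  assumes "\<And>s. 1 \<le> s \<Longrightarrow> \<tau> s = action (c s) s"
  shows "(\<lambda>m. pmf (pending_pmf n p \<tau> t) (Some m)) = state (n - 1) popularity c t"
proof (induction t)
  case 0
  show ?case by (auto simp: pending_pmf_0 pmf_return fun_eq_iff)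
next
  case (Suc t)
  let ?f = "state (n - 1) popularity c t" and ?t = "Suc t"
  have supp: "?f m = 0" if "n - 1 < m" for m
    unfolding Suc[symmetric] using set_pending_pmf[of n p \<tau> t] that by (auto simp: pmf_eq_0_set_pmf)
  have rec: "pmf (pending_pmf n p \<tau> ?t) (Some m')
      = (\<Sum>m\<le>n - 1. ?f m * pmf (bind_pmf (action (c ?t) ?t) (\<lambda>a. slot_pmf (p ?t) a m)) (Some m'))" for m'
    unfolding pmf_pending_Suc using Suc assms[of ?t] by (simp add: fun_eq_iff)
  have pop: "(\<Sum>m\<le>n - 1. ?f m * pmf (slot_pmf (p ?t) (popular ?t) m) (Some m'))
      = step (popularity ?t) ?f m'"
    and unpop: "(\<Sum>m\<le>n - 1. ?f m * pmf (slot_pmf (p ?t) (unpopular ?t) m) (Some m'))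
      = step (1 - popularity ?t) ?f m'" for m'
    using sum_two_kernel[of "n - 1" ?f, OF supp]
    by (simp_all add: pmf_slot_popular pmf_slot_unpopular step_def)
  show ?case
  proof
    fix m'
    show "pmf (pending_pmf n p \<tau> ?t) (Some m') = state (n - 1) popularity c ?t m'"
    proof (cases "c ?t")
      case Popular
      then show ?thesis using pop by (simp add: rec bind_return_pmf)
    next
      case Unpopular
      then show ?thesis using unpop by (simp add: rec bind_return_pmf)
    next
      case Mixed
      have "pmf (bind_pmf (p ?t) (\<lambda>a. slot_pmf (p ?t) a m)) (Some m')
          = popularity ?t * pmf (slot_pmf (p ?t) (popular ?t) m) (Some m')
            + (1 - popularity ?t) * pmf (slot_pmf (p ?t) (unpopular ?t) m) (Some m')" for m
        unfolding pmf_bind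
        by (subst integral_measure_pmf[of "{popular ?t, unpopular ?t}"])
          (use set_pmf_p[of ?t] channels(3)[of ?t] pmf_p[of ?t] in auto)
      then have "pmf (pending_pmf n p \<tau> ?t) (Some m')
        = popularity ?t * (\<Sum>m\<le>n - 1. ?f m * pmf (slot_pmf (p ?t) (popular ?t) m) (Some m'))
          + (1 - popularity ?t) * (\<Sum>m\<le>n - 1. ?f m * pmf (slot_pmf (p ?t) (unpopular ?t) m) (Some m'))"
        using Mixed by (simp add: rec sum_distrib_left sum.distrib distrib_left mult_ac)
      then show ?thesis unfolding pop unpop using Mixed by (simp add: mix_def)
    next
      case Idle
      then show ?thesis
        using pmf_slot_idle[OF channels(1,2,3) set_pmf_p[of ?t]] pmf_p[of ?t]
        by (simp add: rec bind_return_pmf idle_def)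
    qed
  qed
qed

text \<open>Being pending at slot 1 has probability 1, so the conditioning is void, and the summand
  \<open>real t = 1\<close> is the term of \<open>cost\<close> at index 0.\<close>

lemma cond_latency_cost:
  assumes "\<And>s. 1 \<le> s \<Longrightarrow> \<tau> s = action (c s) s"
  shows "cond_latency n p (\<lambda>s _. \<tau> s) 1 [] = cost (n - 1) popularity c"
proof -
  let ?m = "\<lambda>s. mass (n - 1) (state (n - 1) popularity c s)"
  have pend: "cg_pending n p (\<lambda>s _. \<tau> s) (Suc s) [] = ?m s" for s
    using pmf_pending_state[OF assms, of s] by (simp add: cg_pending_nil mass_def fun_eq_iff)
  have one: "?m 0 = 1" by (simp add: mass_def)
  have "(\<lambda>s. ennreal (?m (Suc s))) sums (\<Sum>s. ennreal (?m (Suc s)))" by (intro summable_sums) simp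
  then have "(\<lambda>s. ennreal (?m s)) sums ((\<Sum>s. ennreal (?m (Suc s))) + ennreal (?m 0))"
    by (rule sums_Suc)
  then have "cost (n - 1) popularity c = (\<Sum>s. ennreal (?m (Suc s))) + ennreal (?m 0)"
    unfolding cost_def by (rule sums_unique[symmetric])
  then show ?thesis
    unfolding cond_latency_def using pend pend[of 0] one by (simp add: add.commute)
qed

text \<open>The equilibrium condition at slot 1 with empty history, tested against the deviation
  that plays \<open>c\<close>.\<close>

lemma equilibrium_cost_le:
  assumes "memoryless_equilibrium n 2 p"
  shows "cost (n - 1) popularity (\<lambda>_. Mixed) \<le> cost (n - 1) popularity c"
proof -
  let ?\<sigma> = "\<lambda>s (g :: nat list). action (c s) s"
  have p: "cond_latency n p (\<lambda>s _. p s) 1 [] = cost (n - 1) popularity (\<lambda>_. Mixed)"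
    by (rule cond_latency_cost) simp
  have pending: "length ([] :: nat list) = 1 - 1 \<and> 0 < cg_pending n p (\<lambda>s _. p s) 1 []"
    using cg_pending_nil[of n p p 0] by (simp add: pending_pmf_0 pmf_return indicator_def)
  have valid: "set_pmf (?\<sigma> s g) \<subseteq> {0..2}" for s g
    using support channels(4,5)[of s] by (cases "c s") (auto simp: memoryless_protocol_def)
  have "cond_latency n p (\<lambda>s _. p s) 1 []
      \<le> cond_latency n p (\<lambda>s g. if s < 1 then p s else ?\<sigma> s g) 1 []"
    by (rule assms[unfolded memoryless_equilibrium_def, rule_format, OF le_refl pending valid])
  also have "\<dots> = cost (n - 1) popularity c"
    by (rule cond_latency_cost) simp
  finally show ?thesis unfolding p .
qed

end

theorem theorem2:
  fixes n :: nat and p :: "nat \<Rightarrow> nat pmf"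
  assumes "memoryless_protocol 2 p"
    and "\<forall>t\<ge>1. pmf (p t) 0 = 0"
    and "n > 4"
  shows "\<not> memoryless_equilibrium n 2 p"
proof
  assume eq: "memoryless_equilibrium n 2 p"
  interpret two_channels n p using assms(1,2) by unfold_locales
  interpret contention "n - 1" popularity
    using assms(3) popularity_bounds equilibrium_cost_le[OF eq] by unfold_locales auto
  show False by (rule contradiction)
qed

end
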